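(* Let $d\geq 1$ be an integer. The simple random walk $\mathcal{S}_{(T_\infty,\rho)}$ on $\mathbb{Z}^d$ indexed by the critical geometric Galton-Watson tree conditioned to survive $(T_\infty,\rho)$ is recurrent if and only if $d\leq 4$.
   Context: **The tree $T_\infty$.** The critical geometric Galton-Watson tree is the Galton-Watson plane tree whose offspring distribution is geometric of parameter $1/2$, i.e. $p_k=2^{-k-1}$ for $k\geq 0$. The critical geometric Galton-Watson tree conditioned to survive, $T_\infty$ (also called the uniform infinite plane tree), is the random infinite rooted plane tree constructed as follows. Start with a semi-infinite line of vertices $v_0,v_1,v_2,\ldots$ (the spine; consecutive vertices are joined by an edge), and graft to the left and to the right of each spine vertex an independent critical geometric Galton-Watson tree, the root of each grafted tree being identified with the corresponding spine vertex; all the grafted trees are independent. The root is $\rho=v_0$, the first vertex of the spine. (Equivalently, $T_\infty$ is the limit in distribution, generation by generation, of uniform plane trees with $n$ edges as $n\to\infty$.) **The walk indexed by a tree.** Let $(T,\rho)$ be a (random) infinite rooted tree. Conditionally on $T$, assign to each edge of $T$ an independent random vector uniformly distributed over $\{\pm e_1,\ldots,\pm e_d\}$, where $e_1,\dots,e_d$ is the standard basis of $\mathbb{Z}^d$. For every vertex $u$ of $T$, $\mathcal{S}_{(T,\rho)}(u)\in\mathbb{Z}^d$ is the sum of the vectors assigned to the edges of the unique geodesic path from $\rho$ to $u$; in particular $\mathcal{S}_{(T,\rho)}(\rho)=0$. **Recurrence.** The walk $\mathcal{S}_{(T_\infty,\rho)}$ is called recurrent if almost surely infinitely many vertices of the tree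 are mapped to the origin, i.e. $\#\mathcal{S}_{(T_\infty,\rho)}^{-1}(\{0\})=\infty$ almost surely, with respect to the joint randomness of the tree and of the assigned vectors. *)

theory Defs
  imports "HOL-Probability.Probability"
begin

text \<open>
  Rooted plane trees in Ulam-Harris coding: a vertex is a word of naturals, the root is the
  empty word, and \<open>u @ [i]\<close> is the \<open>i\<close>-th child of \<open>u\<close>, counted from left to right from 0.
\<close>

definition plane_tree :: "nat list set \<Rightarrow> bool" where
  "plane_tree T \<longleftrightarrow> [] \<in> T \<and>
     (\<forall>u i. u @ [i] \<in> T \<longrightarrow> u \<in> T \<and> (\<forall>j\<le>i. u @ [j] \<in> T)) \<and>
     (\<forall>u. finite {i. u @ [i] \<in> T})"

subsection \<open>The critical geometric Galton-Watson tree\<close>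

text \<open>
  \<open>k u\<close> is the number of children of \<open>u\<close>. The offspring numbers are drawn for all words; those
  of words outside the tree are never used.
\<close>

definition gw_tree :: "(nat list \<Rightarrow> nat) \<Rightarrow> nat list set" where
  "gw_tree k = {u. \<forall>i<length u. u ! i < k (take i u)}"

definition gw_space :: "(nat list \<Rightarrow> nat) measure" where
  "gw_space = (\<Pi>\<^sub>M u\<in>UNIV. measure_pmf (geometric_pmf (1 / 2)))"

subsection \<open>The critical geometric Galton-Watson tree conditioned to survive\<close>

text \<open>
  \<open>\<omega> n\<close> is the pair of offspring functions of the trees grafted to the left and to the right
  of the \<open>n\<close>-th spine vertex. The children of that vertex are, from left to right, the children
  of the root of the left tree, the next spine vertex, and the children of the root of the
  right tree. Hence the next spine vertex has as its index the number of children of the root of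
  the left tree, and the labels in the right tree are shifted accordingly.
\<close>

type_synonym spine_config = "nat \<Rightarrow> (nat list \<Rightarrow> nat) \<times> (nat list \<Rightarrow> nat)"

definition T_inf_space :: "spine_config measure" where
  "T_inf_space = (\<Pi>\<^sub>M n\<in>UNIV. gw_space \<Otimes>\<^sub>M gw_space)"

definition spine :: "spine_config \<Rightarrow> nat \<Rightarrow> nat list" where
  "spine \<omega> n = map (\<lambda>m. fst (\<omega> m) []) [0..<n]"

definition T_inf :: "spine_config \<Rightarrow> nat list set" where
  "T_inf \<omega> = (\<Union>n.
     {spine \<omega> n @ u |u. u \<in> gw_tree (fst (\<omega> n))} \<union>
     {spine \<omega> n @ (fst (\<omega> n) [] + 1 + i) # u |i u. i # u \<in> gw_tree (snd (\<omega> n))})"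

subsection \<open>Random walks indexed by a tree\<close>

text \<open>
  \<open>x u\<close> is the vector assigned to the edge between \<open>u \<noteq> []\<close> and its parent. The edges of the
  geodesic from the root to \<open>u\<close> are those above the nonempty prefixes of \<open>u\<close>.
\<close>

definition tree_walk :: "(nat list \<Rightarrow> 'v) \<Rightarrow> nat list \<Rightarrow> 'v::ab_group_add" where
  "tree_walk x u = (\<Sum>j=1..length u. x (take j u))"

definition srw_step :: "(int ^ 'd::finite) pmf" where
  "srw_step = pmf_of_set (range (\<lambda>i. axis i 1) \<union> range (\<lambda>i. - axis i 1))"

text \<open>
  \<open>T\<close> is a random tree defined on the probability space \<open>M\<close>. Independently of it, every word gets
  a vector with law \<open>p\<close>; only those of the words in the tree matter, so that given \<open>T\<close> its edges
  carry independent vectors with law \<open>p\<close>.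
\<close>

definition tree_walk_recurrent ::
  "'w measure \<Rightarrow> ('w \<Rightarrow> nat list set) \<Rightarrow> 'v::ab_group_add pmf \<Rightarrow> bool" where
  "tree_walk_recurrent M T p \<longleftrightarrow>
     (AE (\<omega>, x) in M \<Otimes>\<^sub>M (\<Pi>\<^sub>M u\<in>UNIV. measure_pmf p).
        infinite {u \<in> T \<omega>. tree_walk x u = 0})"

subsection \<open>Basic facts\<close>

lemma pmf_offspring: "pmf (geometric_pmf (1 / 2)) k = 1 / 2 ^ (k + 1)"
  by (simp add: power_divide)

lemma pmf_srw_step:
  fixes v :: "int ^ 'd::finite"
  shows "pmf srw_step v = (if \<exists>i. v = axis i 1 \<or> v = - axis i 1 then 1 / (2 * CARD('d)) else 0)"
proof -
  let ?A = "range (\<lambda>i::'d. axis i (1::int))" and ?B = "range (\<lambda>i::'d. - axis i (1::int))"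
  have inj: "inj (\<lambda>i::'d. axis i (1::int))" "inj (\<lambda>i::'d. - axis i (1::int))"
    by (auto simp: inj_def axis_eq_axis)
  have neq: "axis i (1::int) \<noteq> - axis j 1" for i j :: 'd
  proof
    assume "axis i (1::int) = - axis j 1"
    then have "axis i (1::int) $ i = (- axis j 1) $ i" by simp
    then show False by (simp add: axis_def split: if_splits)
  qed
  have "?A \<inter> ?B = {}" using neq by auto
  then have "card (?A \<union> ?B) = 2 * CARD('d)"
    using inj by (subst card_Un_disjoint) (simp_all add: card_image)
  then show ?thesis
    unfolding srw_step_def by (subst pmf_of_set) (auto simp: indicator_def)
qed

lemma prob_space_gw_space: "prob_space gw_space"
  unfolding gw_space_def by (intro prob_space_PiM measure_pmf.prob_space_axioms)

lemma prob_space_T_inf_space: "prob_space T_inf_space"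
  unfolding T_inf_space_def
  by (intro prob_space_PiM prob_space_pair prob_space_gw_space)

lemma Nil_in_gw_tree [simp]: "[] \<in> gw_tree k"
  by (simp add: gw_tree_def)

lemma snoc_in_gw_tree_iff: "u @ [i] \<in> gw_tree k \<longleftrightarrow> u \<in> gw_tree k \<and> i < k u"
  by (auto simp: gw_tree_def nth_append less_Suc_eq)

lemma plane_tree_gw_tree: "plane_tree (gw_tree k)"
  by (auto simp: plane_tree_def snoc_in_gw_tree_iff)

lemma length_spine [simp]: "length (spine \<omega> n) = n"
  by (simp add: spine_def)

lemma spine_0 [simp]: "spine \<omega> 0 = []"
  by (simp add: spine_def)

lemma spine_Suc: "spine \<omega> (Suc n) = spine \<omega> n @ [fst (\<omega> n) []]"
  by (simp add: spine_def)

lemma spine_in_T_inf: "spine \<omega> n \<in> T_inf \<omega>"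
  unfolding T_inf_def by (force intro: exI[of _ "[]"])

lemma infinite_T_inf: "infinite (T_inf \<omega>)"
proof
  assume "finite (T_inf \<omega>)"
  moreover have "range (spine \<omega>) \<subseteq> T_inf \<omega>"
    using spine_in_T_inf by blast
  ultimately have "finite (length ` range (spine \<omega>))"
    using finite_subset by blast
  then show False
    by (simp add: image_image)
qed

lemma T_inf_left: "u \<in> gw_tree (fst (\<omega> n)) \<Longrightarrow> spine \<omega> n @ u \<in> T_inf \<omega>"
  unfolding T_inf_def by blast

lemma T_inf_right:
  "i # u \<in> gw_tree (snd (\<omega> n)) \<Longrightarrow> spine \<omega> n @ (fst (\<omega> n) [] + 1 + i) # u \<in> T_inf \<omega>"
  unfolding T_inf_def by blast

lemma T_infE:
  assumes "w \<in> T_inf \<omega>"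
  obtains (left) n u where "w = spine \<omega> n @ u" "u \<in> gw_tree (fst (\<omega> n))"
  | (right) n i u where "w = spine \<omega> n @ (fst (\<omega> n) [] + 1 + i) # u"
      "i # u \<in> gw_tree (snd (\<omega> n))"
  using assms unfolding T_inf_def by blast

lemma Cons_in_gw_treeD: "i # u \<in> gw_tree k \<Longrightarrow> i < k []"
  by (auto simp: gw_tree_def)

lemma singleton_in_gw_tree_iff [simp]: "[i] \<in> gw_tree k \<longleftrightarrow> i < k []"
  using snoc_in_gw_tree_iff[of "[]" i k] by simp

lemma spine_split: "m < n \<Longrightarrow> \<exists>r. spine \<omega> n = spine \<omega> m @ fst (\<omega> m) [] # r"
  by (induction n) (auto simp: spine_Suc less_Suc_eq)

lemma T_inf_spine_child:
  assumes "i < fst (\<omega> n) [] + 1 + snd (\<omega> n) []"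
  shows "spine \<omega> n @ [i] \<in> T_inf \<omega>"
proof -
  consider "i < fst (\<omega> n) []" | "i = fst (\<omega> n) []" | "i > fst (\<omega> n) []"
    by linarith
  then show ?thesis
  proof cases
    case 1
    then show ?thesis by (intro T_inf_left) simp
  next
    case 2
    then show ?thesis using spine_in_T_inf[of \<omega> "Suc n"] by (simp add: spine_Suc)
  next
    case 3
    with assms have "[i - fst (\<omega> n) [] - 1] \<in> gw_tree (snd (\<omega> n))"
      by simp
    from T_inf_right[where n = n and \<omega> = \<omega> and u = "[]", OF this] 3 show ?thesis by simp
  qed
qed

lemma spine_child_in_T_inf_iff:
  "spine \<omega> n @ [i] \<in> T_inf \<omega> \<longleftrightarrow> i < fst (\<omega> n) [] + 1 + snd (\<omega> n) []"
proof
  assume "spine \<omega> n @ [i] \<in> T_inf \<omega>"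
  then show "i < fst (\<omega> n) [] + 1 + snd (\<omega> n) []"
  proof (cases rule: T_infE)
    case (left m u)
    from arg_cong[OF left(1), of length] have "m \<le> Suc n" by simp
    then consider "m < n" | "m = n" | "m = Suc n" by linarith
    then show ?thesis
    proof cases
      case 1
      then obtain r where "spine \<omega> n = spine \<omega> m @ fst (\<omega> m) [] # r"
        using spine_split by blast
      with left(1) have "u = fst (\<omega> m) [] # r @ [i]" by simp
      with left(2) show ?thesis by (auto dest: Cons_in_gw_treeD)
    qed (use left in \<open>auto simp: spine_Suc\<close>)
  next
    case (right m j u)
    from arg_cong[OF right(1), of length] have "m \<le> n" by simp
    then consider "m < n" | "m = n" by linarith
    then show ?thesis
    proof cases
      case 1
      then obtain r where "spine \<omega> n = spine \<omega> m @ fst (\<omega> m) [] # r"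
        using spine_split by blast
      with right(1) show ?thesis by simp
    qed (use right in auto)
  qed
qed (rule T_inf_spine_child)

lemma T_inf_childE:
  assumes "w @ [i] \<in> T_inf \<omega>"
  obtains (spine) n where "w = spine \<omega> n" "i < fst (\<omega> n) [] + 1 + snd (\<omega> n) []"
  | (left) n u where "w = spine \<omega> n @ u" "u \<in> gw_tree (fst (\<omega> n))" "i < fst (\<omega> n) u"
  | (right) n j u where "w = spine \<omega> n @ (fst (\<omega> n) [] + 1 + j) # u"
      "j # u \<in> gw_tree (snd (\<omega> n))" "i < snd (\<omega> n) (j # u)"
  using assms
proof (cases rule: T_infE)
  case (left n u)
  show ?thesis
  proof (cases u rule: rev_cases)
    case Nil
    with left(1) obtain m where "n = Suc m"
      by (cases n) auto
    with Nil left(1) show ?thesis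
      by (intro that(1)[of m]) (auto simp: spine_Suc)
  next
    case (snoc u' j)
    with left show ?thesis
      by (intro that(2)[of n u']) (auto simp: snoc_in_gw_tree_iff)
  qed
next
  case (right n j u)
  show ?thesis
  proof (cases u rule: rev_cases)
    case Nil
    with right show ?thesis
      by (intro that(1)[of n]) auto
  next
    case (snoc u' l)
    with right(2) have "(j # u') @ [l] \<in> gw_tree (snd (\<omega> n))" by simp
    with snoc right(1) show ?thesis
      unfolding snoc_in_gw_tree_iff by (intro that(3)[of n j u']) auto
  qed
qed

lemma plane_tree_T_inf: "plane_tree (T_inf \<omega>)"
  unfolding plane_tree_def
proof (intro conjI allI impI)
  show "[] \<in> T_inf \<omega>"
    using spine_in_T_inf[of \<omega> 0] by simp
next
  fix w i assume "w @ [i] \<in> T_inf \<omega>"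
  then show "w \<in> T_inf \<omega>"
    by (cases rule: T_inf_childE) (auto simp del: add_Suc_right
          intro: spine_in_T_inf T_inf_left T_inf_right[simplified])
next
  fix w i j assume "w @ [i] \<in> T_inf \<omega>" and ji: "j \<le> i"
  then show "w @ [j] \<in> T_inf \<omega>"
  proof (cases rule: T_inf_childE)
    case (spine n)
    with ji show ?thesis by (auto intro!: T_inf_spine_child)
  next
    case (left n u)
    with ji have "u @ [j] \<in> gw_tree (fst (\<omega> n))" by (simp add: snoc_in_gw_tree_iff)
    from T_inf_left[where n = n and \<omega> = \<omega>, OF this] left(1) show ?thesis by simp
  next
    case (right n k u)
    with ji have "(k # u) @ [j] \<in> gw_tree (snd (\<omega> n))" unfolding snoc_in_gw_tree_iff by simp
    then have "k # (u @ [j]) \<in> gw_tree (snd (\<omega> n))" by simp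
    from T_inf_right[where n = n and \<omega> = \<omega>, OF this] right(1) show ?thesis by simp
  qed
next
  fix w
  define B where "B n = {..<fst (\<omega> n) [] + 1 + snd (\<omega> n) []} \<union> {..<fst (\<omega> n) (drop n w)} \<union>
    {..<snd (\<omega> n) ((hd (drop n w) - fst (\<omega> n) [] - 1) # tl (drop n w))}" for n
  have "i \<in> (\<Union>n\<le>length w. B n)" if "w @ [i] \<in> T_inf \<omega>" for i
    using that
  proof (cases rule: T_inf_childE)
    case (spine n)
    then show ?thesis by (intro UN_I[of n]) (auto simp: B_def)
  next
    case (left n u)
    then show ?thesis by (intro UN_I[of n]) (auto simp: B_def)
  next
    case (right n k u)
    then show ?thesis by (intro UN_I[of n]) (auto simp: B_def)
  qed
  then have "{i. w @ [i] \<in> T_inf \<omega>} \<subseteq> (\<Union>n\<le>length w. B n)" by blast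
  moreover have "finite (\<Union>n\<le>length w. B n)" by (auto simp: B_def)
  ultimately show "finite {i. w @ [i] \<in> T_inf \<omega>}" by (rule finite_subset)
qed

end

theory Submission
  imports Defs
begin

text \<open>
  Let \<open>p n s\<close> be the probability that the simple random walk is at the opposite of \<open>s\<close> at time \<open>n\<close>;
  it is at most \<open>C n\<^sup>-\<^sup>d\<^sup>/\<^sup>2\<close>. Generation \<open>m\<close> of the tree has mean size at most \<open>2 (m + 1)\<close>, so for
  \<open>d \<ge> 5\<close> the mean number of zeros is finite, being at most the sum of \<open>2 (m + 1) p m 0\<close>.

  For \<open>d \<le> 4\<close> consider the trees grafted to the left of the spine. Given the walk on the spine they
  visit the origin independently. If the \<open>n\<close>-th spine vertex, with \<open>n\<close> of order \<open>4\<^sup>k\<close>, is mapped to \<open>s\<close>,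
  count the zeros of its tree at heights in \<open>[4\<^sup>k, 4\<^sup>k\<^sup>+\<^sup>1)\<close>. The mean is the sum of \<open>p m s\<close> over this
  block, and the second moment is at most the mean times a constant times \<open>k 2\<^sup>k\<^sup>(\<^sup>4\<^sup>-\<^sup>d\<^sup>)\<close>. Hence the
  tree visits the origin with probability at least \<open>c / (k 4\<^sup>k)\<close>, unless \<open>s\<close> lies in the set of points
  where the mean is less than \<open>\<epsilon> 4\<^sup>k 2\<^sup>-\<^sup>k\<^sup>d\<close>. The walk rarely visits this set: by Chebyshev it stays in
  a box of \<open>O(2\<^sup>k\<^sup>d)\<close> points, each of which contributes at most \<open>\<epsilon> 4\<^sup>k 2\<^sup>-\<^sup>k\<^sup>d\<close> to its expected number
  of visits. No lower bound on \<open>p\<close> is needed. A block contributes \<open>3c / k\<close> to the sum of the hitting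
  probabilities, which therefore diverges.
\<close>

subsection \<open>Splitting product measures\<close>

lemma measurable_PiM_UNIV:
  assumes "\<And>i. (\<lambda>z. f z i) \<in> measurable N (M i)"
  shows "f \<in> measurable N (PiM UNIV M)"
  using measurable_PiM_single'[of UNIV "\<lambda>i z. f z i" N M] assms
  by (auto dest: measurable_space)

lemma measurable_PiM_mix:
  "(\<lambda>(x, y) i. if i \<in> A then x i else y i) \<in> measurable (PiM UNIV M \<Otimes>\<^sub>M PiM UNIV M) (PiM UNIV M)"
proof (rule measurable_PiM_UNIV)
  fix i
  show "(\<lambda>z. (case z of (x, y) \<Rightarrow> \<lambda>i. if i \<in> A then x i else y i) i)
    \<in> measurable (PiM UNIV M \<Otimes>\<^sub>M PiM UNIV M) (M i)"
    by (cases "i \<in> A") (simp_all add: case_prod_beta)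
qed

text \<open>It suffices to compare finite cylinders. The preimage of a cylinder over
  \<open>J\<close> is the product of the cylinders over \<open>J \<inter> A\<close> and
  \<open>J - A\<close>, so its mass is the full product over \<open>J\<close>.\<close>

lemma distr_PiM_mix:
  assumes M: "\<And>i. prob_space (M i)"
  shows "distr (PiM UNIV M \<Otimes>\<^sub>M PiM UNIV M) (PiM UNIV M) (\<lambda>(x, y) i. if i \<in> A then x i else y i) =
    PiM UNIV M" (is "?L = _")
proof -
  interpret M: prob_space "M i" for i by (rule M)
  interpret P: product_prob_space M UNIV by unfold_locales
  interpret PP: pair_prob_space "PiM UNIV M" "PiM UNIV M" ..
  show ?thesis
  proof (rule P.PiM_eq)
    fix J F assume J: "finite J" and F: "\<And>j. j \<in> J \<Longrightarrow> F j \<in> sets (M j)"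
    let ?E = "\<lambda>K. prod_emb UNIV M K (\<Pi>\<^sub>E j\<in>K. F j)"
    have s: "?E K \<in> sets (PiM UNIV M)" if "K \<subseteq> J" for K
      using that F J finite_subset[of K J] by (intro sets_PiM_I) auto
    have "emeasure ?L (?E J) = emeasure (PiM UNIV M \<Otimes>\<^sub>M PiM UNIV M) (?E (J \<inter> A) \<times> ?E (J - A))"
      using F[THEN sets.sets_into_space]
      by (subst emeasure_distr[OF measurable_PiM_mix s])
        (auto intro!: arg_cong2[where f = emeasure]
          simp: prod_emb_def space_pair_measure space_PiM PiE_iff split: if_splits)
    also have "\<dots> = (\<Prod>j\<in>J \<inter> A. emeasure (M j) (F j)) * (\<Prod>j\<in>J - A. emeasure (M j) (F j))"
      using J F s by (subst P.emeasure_pair_measure_Times)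
        (auto intro!: arg_cong2[where f = "(*)"] emeasure_PiM_emb M)
    also have "\<dots> = (\<Prod>j\<in>J. emeasure (M j) (F j))"
      using J by (rule prod.Int_Diff[symmetric])
    finally show "emeasure ?L (?E J) = (\<Prod>j\<in>J. emeasure (M j) (F j))" .
  qed simp
qed

text \<open>The form in which independence is used throughout: the coordinates outside
  \<open>A\<close> are resampled from a second copy, so that a factor reading only \<open>A\<close>
  and a factor reading only the complement depend on different integration variables.\<close>

lemma nn_integral_PiM_mix:
  assumes M: "\<And>i. prob_space (M i)" and f: "f \<in> borel_measurable (PiM UNIV M)"
  shows "(\<integral>\<^sup>+ x. f x \<partial>PiM UNIV M) =
    (\<integral>\<^sup>+ x. \<integral>\<^sup>+ y. f (\<lambda>i. if i \<in> A then x i else y i) \<partial>PiM UNIV M \<partial>PiM UNIV M)"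
proof -
  interpret P: prob_space "PiM UNIV M" using M by (rule prob_space_PiM)
  have "(\<integral>\<^sup>+ x. f x \<partial>PiM UNIV M) = (\<integral>\<^sup>+ x. f x \<partial>distr (PiM UNIV M \<Otimes>\<^sub>M PiM UNIV M) (PiM UNIV M)
    (\<lambda>(x, y) i. if i \<in> A then x i else y i))"
    by (simp add: distr_PiM_mix[OF M])
  also have "\<dots> = (\<integral>\<^sup>+ z. f (case z of (x, y) \<Rightarrow> (\<lambda>i. if i \<in> A then x i else y i)) \<partial>(PiM UNIV M \<Otimes>\<^sub>M PiM UNIV M))"
    using f by (intro nn_integral_distr measurable_PiM_mix) simp
  also have "\<dots> = (\<integral>\<^sup>+ x. \<integral>\<^sup>+ y. f (\<lambda>i. if i \<in> A then x i else y i) \<partial>PiM UNIV M \<partial>PiM UNIV M)"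
    using measurable_compose[OF measurable_PiM_mix f]
    by (subst P.nn_integral_fst[symmetric]) (simp_all add: case_prod_unfold cong: if_cong)
  finally show ?thesis .
qed

lemma measurable_PiM_reindex:
  "(\<lambda>x i. x (g i)) \<in> measurable (PiM UNIV (\<lambda>_. M)) (PiM UNIV (\<lambda>_. M))"
  by (rule measurable_PiM_UNIV) simp

text \<open>Used with \<open>g = (#) i\<close>, which passes to the subtree below child
  \<open>i\<close>, and with \<open>g = Suc\<close>, which drops the first spine vertex.\<close>

lemma nn_integral_PiM_reindex:
  assumes M: "prob_space M" and g: "inj g" and f: "f \<in> borel_measurable (PiM UNIV (\<lambda>_. M))"
  shows "(\<integral>\<^sup>+ x. f (\<lambda>i. x (g i)) \<partial>PiM UNIV (\<lambda>_. M)) = (\<integral>\<^sup>+ x. f x \<partial>PiM UNIV (\<lambda>_. M))"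
proof -
  have "distr (PiM UNIV (\<lambda>_. M)) (PiM UNIV (\<lambda>_. M)) (\<lambda>x i. x (g i)) = PiM UNIV (\<lambda>_. M)"
    using distr_PiM_reindex[where K = UNIV and I = UNIV and f = g and M = "\<lambda>_. M"] M g
    by (simp add: restrict_def)
  then have "(\<integral>\<^sup>+ x. f x \<partial>PiM UNIV (\<lambda>_. M)) =
    (\<integral>\<^sup>+ x. f x \<partial>distr (PiM UNIV (\<lambda>_. M)) (PiM UNIV (\<lambda>_. M)) (\<lambda>x i. x (g i)))"
    by simp
  also have "\<dots> = (\<integral>\<^sup>+ x. f (\<lambda>i. x (g i)) \<partial>PiM UNIV (\<lambda>_. M))"
    using f by (intro nn_integral_distr measurable_PiM_reindex) simp
  finally show ?thesis ..
qed

lemma nn_integral_PiM_component: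
  fixes i :: 'i
  assumes M: "\<And>i. prob_space (M i)" and f: "f \<in> borel_measurable (M i)"
  shows "(\<integral>\<^sup>+ x. f (x i) \<partial>PiM UNIV M) = (\<integral>\<^sup>+ a. f a \<partial>M i)"
proof -
  interpret M: prob_space "M j" for j by (rule M)
  interpret P: product_prob_space M UNIV by unfold_locales
  have "(\<integral>\<^sup>+ a. f a \<partial>M i) = (\<integral>\<^sup>+ a. f a \<partial>distr (PiM UNIV M) (M i) (\<lambda>x. x i))"
    by (simp add: P.PiM_component)
  also have "\<dots> = (\<integral>\<^sup>+ x. f (x i) \<partial>PiM UNIV M)"
    using f by (intro nn_integral_distr) simp_all
  finally show ?thesis ..
qed

subsection \<open>The return probabilities of the simple random walk\<close>

text \<open>The transition operator of the simple random walk. Its iterates act on functions of the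
  starting point, which fits recursions that split off the first edge below the root.\<close>

definition step_avg :: "(int ^ 'd::finite \<Rightarrow> real) \<Rightarrow> int ^ 'd \<Rightarrow> real" where
  "step_avg f s = (\<Sum>j\<in>UNIV. f (s + axis j 1) + f (s - axis j 1)) / (2 * real CARD('d))"

definition hit_prob :: "nat \<Rightarrow> int ^ 'd::finite \<Rightarrow> real" where
  "hit_prob n = (step_avg ^^ n) (\<lambda>s. if s = 0 then 1 else 0)"

text \<open>The probability that simple random walk on the integers goes from \<open>y\<close> to 0
  in \<open>m\<close> steps.\<close>

primrec bern_ker :: "nat \<Rightarrow> int \<Rightarrow> real" where
  "bern_ker 0 y = (if y = 0 then 1 else 0)"
| "bern_ker (Suc m) y = (bern_ker m (y + 1) + bern_ker m (y - 1)) / 2"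

text \<open>
  The expectation of \<open>F\<close> at the numbers of steps made in each coordinate direction, a multinomial
  vector. Given these numbers the coordinates of the walk are independent.
\<close>

primrec multi_avg :: "nat \<Rightarrow> (('d::finite \<Rightarrow> nat) \<Rightarrow> real) \<Rightarrow> real" where
  "multi_avg 0 F = F (\<lambda>_. 0)"
| "multi_avg (Suc n) F = (\<Sum>j\<in>UNIV. multi_avg n (\<lambda>N. F (N(j := Suc (N j))))) / real CARD('d)"

lemma multi_avg_mono: "(\<And>N. F N \<le> G N) \<Longrightarrow> multi_avg n F \<le> multi_avg n G"
  by (induction n arbitrary: F G) (auto intro!: divide_right_mono sum_mono)

lemma multi_avg_add: "multi_avg n (\<lambda>N. F N + G N) = multi_avg n F + multi_avg n G"
  by (induction n arbitrary: F G) (auto simp: sum.distrib add_divide_distrib)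

lemma multi_avg_cmult: "multi_avg n (\<lambda>N. c * F N) = c * multi_avg n F"
  by (induction n arbitrary: F) (auto simp: sum_distrib_left)

lemma multi_avg_const [simp]: "multi_avg n (\<lambda>N::'d::finite \<Rightarrow> nat. c) = c"
  by (induction n) auto

text \<open>Size biasing of the multinomial law: \<open>N j\<close> is a sum over the
  \<open>n + 1\<close> steps of the indicators of direction \<open>j\<close>, and conditioning on
  one such step leaves \<open>n\<close> free steps and one forced step. Read from right to left, it
  trades a weight at \<open>N j + 1\<close> for a factor of order \<open>1 / n\<close>.\<close>

lemma multi_avg_count:
  "multi_avg (Suc n) (\<lambda>N::'d::finite \<Rightarrow> nat. real (N j) * F N) =
    real (Suc n) / real CARD('d) * multi_avg n (\<lambda>N. F (N(j := Suc (N j))))"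
proof (induction n arbitrary: F)
  case 0
  have "(\<Sum>k\<in>UNIV. real (if j = k then Suc 0 else 0) * F ((\<lambda>_. 0)(k := Suc 0))) =
    (\<Sum>k\<in>UNIV. if j = k then F ((\<lambda>_. 0)(k := Suc 0)) else 0)"
    by (intro sum.cong) auto
  then show ?case by (simp add: fun_upd_def)
next
  case (Suc n)
  let ?d = "real CARD('d)"
  let ?up = "\<lambda>N k. N(k := Suc (N k))"
  \<comment> \<open>The step that is split off adds one to the count exactly when it goes in
    direction \<open>j\<close>; the remaining count is left to the induction hypothesis.\<close>
  have split: "real (?up N k j) * F (?up N k) =
    real (N j) * F (?up N k) + (if k = j then F (?up N j) else 0)" for N k
    by (auto simp: algebra_simps)
  have "multi_avg (Suc (Suc n)) (\<lambda>N. real (N j) * F N) =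
    (\<Sum>k\<in>UNIV. multi_avg (Suc n) (\<lambda>N. real (?up N k j) * F (?up N k))) / ?d"
    by (simp only: multi_avg.simps)
  also have "\<dots> = (\<Sum>k\<in>UNIV. multi_avg (Suc n)
      (\<lambda>N. real (N j) * F (?up N k) + (if k = j then F (?up N j) else 0))) / ?d"
    unfolding split ..
  also have "(\<Sum>k\<in>UNIV. multi_avg (Suc n) (\<lambda>N. real (N j) * F (?up N k) + (if k = j then F (?up N j) else 0)))
    = (\<Sum>k\<in>UNIV. real (Suc n) / ?d * multi_avg n (\<lambda>N. F (?up (?up N j) k))
        + (if k = j then multi_avg (Suc n) (\<lambda>N. F (?up N j)) else 0))"
  proof (intro sum.cong refl)
    fix k
    have "multi_avg (Suc n) (\<lambda>N. if k = j then F (?up N j) else 0) =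
      (if k = j then multi_avg (Suc n) (\<lambda>N. F (?up N j)) else 0)"
      by (cases "k = j") (simp_all only: if_True if_False multi_avg_const simp_thms)
    then show "multi_avg (Suc n) (\<lambda>N. real (N j) * F (?up N k) + (if k = j then F (?up N j) else 0)) =
      real (Suc n) / ?d * multi_avg n (\<lambda>N. F (?up (?up N j) k))
        + (if k = j then multi_avg (Suc n) (\<lambda>N. F (?up N j)) else 0)"
      by (simp only: multi_avg_add Suc.IH)
  qed
  also have "\<dots> = real (Suc n) / ?d * (\<Sum>k\<in>UNIV. multi_avg n (\<lambda>N. F (?up (?up N j) k)))
       + multi_avg (Suc n) (\<lambda>N. F (?up N j))"
    by (simp only: sum.distrib sum_distrib_left) simp
  also have "(\<Sum>k\<in>UNIV. multi_avg n (\<lambda>N. F (?up (?up N j) k)))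
     = (\<Sum>k\<in>UNIV. multi_avg n (\<lambda>N. F (?up (?up N k) j)))"
  proof (intro sum.cong refl)
    fix k
    have "?up (?up N j) k = ?up (?up N k) j" for N :: "'d \<Rightarrow> nat" by (auto simp: fun_eq_iff)
    then show "multi_avg n (\<lambda>N. F (?up (?up N j) k)) = multi_avg n (\<lambda>N. F (?up (?up N k) j))" by simp
  qed
  also have "\<dots> = ?d * multi_avg (Suc n) (\<lambda>N. F (?up N j))" by simp
  finally have "multi_avg (Suc (Suc n)) (\<lambda>N. real (N j) * F N) =
    (real (Suc n) / ?d * (?d * multi_avg (Suc n) (\<lambda>N. F (?up N j))) + multi_avg (Suc n) (\<lambda>N. F (?up N j))) / ?d" .
  moreover have "(real (Suc n) / ?d * (?d * M) + M) / ?d = real (Suc (Suc n)) / ?d * M" for M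
    by (simp add: field_simps)
  ultimately show ?case by (simp only:)
qed

text \<open>Each factor \<open>1 / (N j + 1)\<close> is removed by size biasing at the price of
  \<open>d / (n + 1)\<close>. The number of steps grows by one each time, which only improves the
  later factors.\<close>

lemma multi_avg_prod_inverse:
  fixes J :: "'d::finite set"
  shows "multi_avg n (\<lambda>N. \<Prod>j\<in>J. 1 / real (Suc (N j))) \<le> (real CARD('d) / real (Suc n)) ^ card J"
proof -
  have "finite J" by simp
  then show ?thesis
  proof (induction J arbitrary: n)
    case empty
    then show ?case by simp
  next
    case (insert j J)
    let ?d = "real CARD('d)"
    define G :: "('d \<Rightarrow> nat) \<Rightarrow> real" where "G N = (\<Prod>k\<in>J. 1 / real (Suc (N k)))" for N
    have G: "G (N(j := m)) = G N" "0 \<le> G N" for N m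
      using insert.hyps unfolding G_def by (auto intro!: prod.cong prod_nonneg)
    have "multi_avg n (\<lambda>N. \<Prod>k\<in>insert j J. 1 / real (Suc (N k))) = multi_avg n (\<lambda>N. G N / real (Suc (N j)))"
      using insert.hyps by (simp add: G_def)
    also have "\<dots> = multi_avg n (\<lambda>N. (\<lambda>N. G N / real (N j)) (N(j := Suc (N j))))"
      by (simp add: G)
    also have "\<dots> = ?d / real (Suc n) * multi_avg (Suc n) (\<lambda>N. real (N j) * (G N / real (N j)))"
      by (subst multi_avg_count) simp
    \<comment> \<open>The two integrands agree except at \<open>N j = 0\<close>, where division by
      zero makes the left one 0.\<close>
    also have "\<dots> \<le> ?d / real (Suc n) * multi_avg (Suc n) G"
      by (intro mult_left_mono multi_avg_mono) (auto simp: G)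
    also have "\<dots> \<le> ?d / real (Suc n) * (?d / real (Suc (Suc n))) ^ card J"
      unfolding G_def by (intro mult_left_mono insert.IH) auto
    also have "\<dots> \<le> ?d / real (Suc n) * (?d / real (Suc n)) ^ card J"
      by (intro mult_left_mono power_mono divide_left_mono) auto
    finally show ?case using insert.hyps by simp
  qed
qed

section \<open>Decay of the one-dimensional kernel\<close>

lemma bern_ker_nonneg: "0 \<le> bern_ker m y"
  by (induction m arbitrary: y) auto

text \<open>Pascal's rule. The clauses share one induction because at \<open>k = 0\<close> the
  recursion looks to the left of \<open>- m\<close>, where the third clause gives 0. Points to the
  right of \<open>m\<close> belong to the first clause, with a vanishing binomial
  coefficient.\<close>

lemma bern_ker_binomial:
  "bern_ker m (2 * int k - int m) = real (m choose k) / 2 ^ m"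
  "odd (y + int m) \<Longrightarrow> bern_ker m y = 0"
  "y < - int m \<Longrightarrow> bern_ker m y = 0"
proof (induction m arbitrary: k y)
  case 0
  { case 1 then show ?case by (cases k) auto next case 2 then show ?case by auto next case 3 then show ?case by auto }
next
  case (Suc m)
  { case 1
    show ?case
    proof (cases k)
      case 0
      then show ?thesis using Suc.IH(1)[of 0] Suc.IH(3)[of "- 2 - int m"] by simp
    next
      case [simp]: (Suc l)
      have "2 * int k - int (Suc m) + 1 = 2 * int k - int m"
        "2 * int k - int (Suc m) - 1 = 2 * int l - int m" by auto
      then have "bern_ker (Suc m) (2 * int k - int (Suc m)) = (bern_ker m (2 * int k - int m) + bern_ker m (2 * int l - int m)) / 2"
        unfolding bern_ker.simps by presburger
      also have "\<dots> = (real (m choose k) / 2 ^ m + real (m choose l) / 2 ^ m) / 2"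
        unfolding Suc.IH(1) ..
      finally show ?thesis by (simp add: field_simps)
    qed
  next
    case 2
    then have "odd ((y + 1) + int m)" "odd ((y - 1) + int m)" by auto
    then show ?case by (simp add: Suc.IH(2) del: even_add)
  next
    case 3
    then show ?case using Suc.IH(3)[of "y+1"] Suc.IH(3)[of "y-1"] by simp }
qed

text \<open>Passing from \<open>n\<close> to \<open>n + 1\<close> multiplies the normalized
  coefficient by \<open>(2 n + 1) / (2 n + 2)\<close>. As
  \<open>(2 n + 1) (2 n + 3) \<le> (2 n + 2)^2\<close>, the left-hand side decreases from its value
  1 at \<open>n = 0\<close>.\<close>

lemma central_binomial_upper: "(real (2 * n choose n) / 4 ^ n)\<^sup>2 * real (2 * n + 1) \<le> 1"
proof (induction n)
  case (Suc n)
  let ?a = "\<lambda>n. real (2 * n choose n) / 4 ^ n"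
  have "Suc n * (2 * Suc n choose Suc n) = 2 * (2 * n + 1) * (2 * n choose n)"
  proof -
    have 1: "Suc n * (2 * Suc n choose Suc n) = 2 * Suc n * (2 * n + 1 choose n)"
      using Suc_times_binomial[of n "2 * n + 1"] by simp
    have 2: "Suc n * (2 * n + 1 choose Suc n) = (2 * n + 1) * (2 * n choose n)"
      using Suc_times_binomial[of n "2 * n"] by simp
    have 3: "(2 * n + 1 choose n) = (2 * n + 1 choose Suc n)"
      using binomial_symmetric[of n "2 * n + 1"] by simp
    show ?thesis using 1 2 unfolding 3 by (simp add: algebra_simps)
  qed
  then have "real (Suc n) * real (2 * Suc n choose Suc n) = 2 * (2 * real n + 1) * real (2 * n choose n)"
    by (metis (no_types, lifting) of_nat_mult of_nat_add of_nat_1 of_nat_numeral)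
  then have "real (2 * Suc n choose Suc n) = 2 * (2 * real n + 1) * real (2 * n choose n) / real (Suc n)"
    by (metis nonzero_mult_div_cancel_left of_nat_neq_0)
  then have a: "?a (Suc n) = ?a n * ((2 * real n + 1) / (2 * real n + 2))"
    by (simp only:) (simp add: divide_simps, simp add: algebra_simps)
  have "((2 * real n + 1) / (2 * real n + 2))\<^sup>2 * real (2 * Suc n + 1) \<le> real (2 * n + 1)"
    by (simp add: divide_simps) (simp add: power2_eq_square algebra_simps)
  then have "(?a n)\<^sup>2 * (((2 * real n + 1) / (2 * real n + 2))\<^sup>2 * real (2 * Suc n + 1)) \<le> (?a n)\<^sup>2 * real (2 * n + 1)"
    by (intro mult_left_mono) auto
  from order_trans[OF this Suc.IH] show ?case
    unfolding a power_mult_distrib by (simp only: mult.assoc)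
qed simp

lemma bern_ker_even_le: "bern_ker (2 * n) y \<le> 1 / sqrt (real (2 * n + 1))"
proof -
  have "bern_ker (2 * n) y \<le> real (2 * n choose n) / 4 ^ n"
  proof (cases "odd y \<or> y < - int (2 * n)")
    case True
    then show ?thesis using bern_ker_binomial(2,3)[where m = "2 * n" and y = y] by fastforce
  next
    case False
    then obtain k where "y = 2 * int k - int (2 * n)"
      by (intro that[of "nat ((y + 2 * int n) div 2)"]) auto
    then show ?thesis
      using binomial_maximum'[of n k] bern_ker_binomial(1)[of "2 * n" k]
      by (simp add: power_mult divide_right_mono)
  qed
  also have "\<dots> \<le> 1 / sqrt (real (2 * n + 1))"
  proof (rule power2_le_imp_le)
    show "(real (2 * n choose n) / 4 ^ n)\<^sup>2 \<le> (1 / sqrt (real (2 * n + 1)))\<^sup>2"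
      using central_binomial_upper[of n] by (simp add: power_divide field_simps)
  qed auto
  finally show ?thesis .
qed

text \<open>An odd number of steps is reduced to the even case by splitting off one step. The factor
  \<open>sqrt 2\<close> pays for the lost step, since
  \<open>1 / m \<le> 2 / (m + 1)\<close>.\<close>

lemma bern_ker_le: "bern_ker m y \<le> sqrt 2 * sqrt (1 / real (Suc m))"
proof (cases "even m")
  case True
  then obtain n where "m = 2 * n" by (elim evenE)
  with bern_ker_even_le[of n y] have "bern_ker m y \<le> sqrt (1 / real (Suc m))" by (simp add: real_sqrt_divide)
  also have "\<dots> \<le> sqrt 2 * sqrt (1 / real (Suc m))"
    using mult_right_mono[of 1 "sqrt 2" "sqrt (1 / real (Suc m))"] by simp
  finally show ?thesis .
next
  case False
  then obtain n where m: "m = Suc (2 * n)" by (elim oddE) auto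
  have "bern_ker m y \<le> 1 / sqrt (real (2 * n + 1))"
    using bern_ker_even_le[of n "y+1"] bern_ker_even_le[of n "y-1"] by (simp add: m)
  also have "1 / sqrt (real (2 * n + 1)) = sqrt (1 / real (2 * n + 1))"
    by (simp add: real_sqrt_divide)
  also have "\<dots> \<le> sqrt (2 * (1 / real (Suc m)))"
    by (intro real_sqrt_le_mono) (simp add: m field_simps)
  finally have "bern_ker m y \<le> sqrt (2 * (1 / real (Suc m)))" .
  then show ?thesis
    by (simp only: real_sqrt_mult)
qed

text \<open>A step along axis \<open>j\<close> affects only the \<open>j\<close>-th factor of the
  product, and averaging over its two signs is exactly the recursion of
  \<open>bern_ker\<close>.\<close>

lemma hit_prob_multi_avg:
  fixes s :: "int ^ 'd::finite"
  shows "hit_prob n s = multi_avg n (\<lambda>N. \<Prod>j\<in>UNIV. bern_ker (N j) (s $ j))"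
proof (induction n arbitrary: s)
  case 0
  show ?case
  proof (cases "s = 0")
    case False
    then obtain j where "s $ j \<noteq> 0" by (auto simp: vec_eq_iff)
    then have "(\<Prod>j\<in>UNIV. bern_ker 0 (s $ j)) = 0" by (intro prod_zero) auto
    with False show ?thesis by (simp add: hit_prob_def)
  qed (simp add: hit_prob_def)
next
  case (Suc n)
  have *: "(\<Prod>k\<in>UNIV. bern_ker (N k) ((s + axis j 1) $ k)) + (\<Prod>k\<in>UNIV. bern_ker (N k) ((s - axis j 1) $ k))
    = 2 * (\<Prod>k\<in>UNIV. bern_ker ((N(j := Suc (N j))) k) (s $ k))" for N j
  proof -
    have a: "(\<Prod>k\<in>UNIV. f k) = f j * (\<Prod>k\<in>UNIV - {j}. f k)" for f :: "'d \<Rightarrow> real"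
      by (rule prod.remove) auto
    have b: "(\<Prod>k\<in>UNIV - {j}. bern_ker (N k) ((s + axis j 1) $ k)) = (\<Prod>k\<in>UNIV - {j}. bern_ker (N k) (s $ k))"
      "(\<Prod>k\<in>UNIV - {j}. bern_ker (N k) ((s - axis j 1) $ k)) = (\<Prod>k\<in>UNIV - {j}. bern_ker (N k) (s $ k))"
      "(\<Prod>k\<in>UNIV - {j}. bern_ker ((N(j := Suc (N j))) k) (s $ k)) = (\<Prod>k\<in>UNIV - {j}. bern_ker (N k) (s $ k))"
      by (auto intro!: prod.cong simp: axis_def)
    show ?thesis unfolding a b by (simp add: axis_def algebra_simps)
  qed
  have "hit_prob (Suc n) s = step_avg (hit_prob n) s" by (simp add: hit_prob_def)
  also have "\<dots> = (\<Sum>j\<in>UNIV. multi_avg n (\<lambda>N. (\<Prod>k\<in>UNIV. bern_ker (N k) ((s + axis j 1) $ k))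
      + (\<Prod>k\<in>UNIV. bern_ker (N k) ((s - axis j 1) $ k)))) / (2 * real CARD('d))"
    unfolding step_avg_def Suc.IH multi_avg_add ..
  also have "\<dots> = multi_avg (Suc n) (\<lambda>N. \<Prod>k\<in>UNIV. bern_ker (N k) (s $ k))"
    unfolding * multi_avg_cmult by (simp add: sum_distrib_left[symmetric])
  finally show ?case .
qed

lemma sqrt_prod: "sqrt (\<Prod>i\<in>A. f i) = (\<Prod>i\<in>A. sqrt (f i))"
  by (induction A rule: infinite_finite_induct) (simp_all add: real_sqrt_mult)

text \<open>
  The square root of the product of the \<open>1 / (N j + 1)\<close> is replaced by its tangent at the square of
  \<open>l\<close>, so that the exact mean of the product can be used.
\<close>

lemma hit_prob_upper:
  "\<exists>C>0. \<forall>n (s :: int ^ 'd::finite). hit_prob n s \<le> C / sqrt (real (Suc n)) ^ CARD('d)"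
proof (intro exI conjI allI)
  fix n and s :: "int ^ 'd"
  let ?d = "CARD('d)"
  define l where "l = sqrt ((real ?d / real (Suc n)) ^ ?d)"
  have l: "0 < l" unfolding l_def by simp
  have l2: "l\<^sup>2 = (real ?d / real (Suc n)) ^ ?d" unfolding l_def by simp
  let ?W = "\<lambda>N::'d \<Rightarrow> nat. \<Prod>j\<in>UNIV. 1 / real (Suc (N j))"
  have "hit_prob n s \<le> multi_avg n (\<lambda>N. sqrt 2 ^ ?d * (1 / (2 * l) * ?W N + l / 2))"
    unfolding hit_prob_multi_avg
  proof (rule multi_avg_mono)
    fix N :: "'d \<Rightarrow> nat"
    have W: "0 \<le> ?W N" by (intro prod_nonneg) auto
    have "(\<Prod>j\<in>UNIV. bern_ker (N j) (s $ j)) \<le> (\<Prod>j\<in>UNIV. sqrt 2 * sqrt (1 / real (Suc (N j))))"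
      by (intro prod_mono conjI bern_ker_nonneg bern_ker_le)
    also have "\<dots> = sqrt 2 ^ ?d * sqrt (?W N)"
      by (simp only: prod.distrib sqrt_prod) simp
    also have "sqrt (?W N) \<le> 1 / (2 * l) * ?W N + l / 2"
    proof -
      have "0 \<le> (sqrt (?W N) - l)\<^sup>2" by simp
      also have "\<dots> = ?W N - 2 * l * sqrt (?W N) + l\<^sup>2"
        using W by (simp add: power2_diff)
      finally show ?thesis using l by (simp add: field_simps power2_eq_square)
    qed
    finally show "(\<Prod>j\<in>UNIV. bern_ker (N j) (s $ j)) \<le> sqrt 2 ^ ?d * (1 / (2 * l) * ?W N + l / 2)"
      by simp
  qed
  also have "\<dots> = sqrt 2 ^ ?d * (1 / (2 * l) * multi_avg n ?W + l / 2)"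
    by (simp only: multi_avg_cmult multi_avg_add multi_avg_const)
  also have "\<dots> \<le> sqrt 2 ^ ?d * (1 / (2 * l) * l\<^sup>2 + l / 2)"
    using multi_avg_prod_inverse[of n "UNIV :: 'd set"] l unfolding l2
    by (intro mult_left_mono add_right_mono) auto
  also have "\<dots> = sqrt 2 ^ ?d * l" using l by (simp add: power2_eq_square)
  also have "\<dots> = sqrt 2 ^ ?d * sqrt (real ?d) ^ ?d / sqrt (real (Suc n)) ^ ?d"
    by (simp add: l_def real_sqrt_power real_sqrt_divide power_divide)
  finally show "hit_prob n s \<le> (sqrt 2 ^ ?d * sqrt (real ?d) ^ ?d) / sqrt (real (Suc n)) ^ ?d" .
qed simp

subsection \<open>Fields on words and critical trees\<close>

definition word_field :: "'a pmf \<Rightarrow> (nat list \<Rightarrow> 'a) measure" where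
  "word_field p = PiM UNIV (\<lambda>_. measure_pmf p)"

lemma gw_space_eq: "gw_space = word_field (geometric_pmf (1 / 2))"
  by (simp add: gw_space_def word_field_def)

lemma prob_space_word_field: "prob_space (word_field p)"
  unfolding word_field_def by (intro prob_space_PiM measure_pmf.prob_space_axioms)

lemma measurable_word_field_component [measurable]:
  "(\<lambda>x. x u) \<in> measurable (word_field p) (count_space UNIV)"
proof -
  have "(\<lambda>x. x u) \<in> measurable (word_field p) (measure_pmf p)"
    unfolding word_field_def by simp
  then show ?thesis by simp
qed

lemma measurable_word_field_child:
  "(\<lambda>x u. x (i # u)) \<in> measurable (word_field p) (word_field p)"
  unfolding word_field_def by (rule measurable_PiM_reindex)

lemma nn_integral_word_field_child:
  assumes "f \<in> borel_measurable (word_field p)"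
  shows "(\<integral>\<^sup>+ x. f (\<lambda>u. x (i # u)) \<partial>word_field p) = (\<integral>\<^sup>+ x. f x \<partial>word_field p)"
  using assms unfolding word_field_def
  by (intro nn_integral_PiM_reindex[where g = "(#) i"] measure_pmf.prob_space_axioms) auto

lemma nn_integral_word_field_mix:
  assumes "f \<in> borel_measurable (word_field p)"
  shows "(\<integral>\<^sup>+ x. f x \<partial>word_field p) =
    (\<integral>\<^sup>+ x. \<integral>\<^sup>+ y. f (\<lambda>u. if u \<in> A then x u else y u) \<partial>word_field p \<partial>word_field p)"
  using assms unfolding word_field_def
  by (intro nn_integral_PiM_mix measure_pmf.prob_space_axioms)

text \<open>By \<open>root\<close> the function \<open>f a\<close> ignores the label at the empty
  word. All other labels can therefore be resampled independently of that label.\<close>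

lemma nn_integral_word_field_root:
  fixes f :: "'a::countable \<Rightarrow> (nat list \<Rightarrow> 'a) \<Rightarrow> ennreal"
  assumes f [measurable]: "\<And>a. f a \<in> borel_measurable (word_field p)"
    and root: "\<And>a x y. (\<And>u. u \<noteq> [] \<Longrightarrow> x u = y u) \<Longrightarrow> f a x = f a y"
  shows "(\<integral>\<^sup>+ x. f (x []) x \<partial>word_field p) = (\<integral>\<^sup>+ a. \<integral>\<^sup>+ x. f a x \<partial>word_field p \<partial>measure_pmf p)"
proof -
  have "(\<integral>\<^sup>+ x. f (x []) x \<partial>word_field p) =
    (\<integral>\<^sup>+ x. \<integral>\<^sup>+ y. f (x []) (\<lambda>u. if u \<in> {[]} then x u else y u) \<partial>word_field p \<partial>word_field p)"
    by (subst nn_integral_word_field_mix[of _ p "{[]}"])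
      (auto intro!: measurable_compose_countable[OF f])
  also have "\<dots> = (\<integral>\<^sup>+ x. \<integral>\<^sup>+ y. f (x []) y \<partial>word_field p \<partial>word_field p)"
    by (intro nn_integral_cong root) simp
  also have "\<dots> = (\<integral>\<^sup>+ a. \<integral>\<^sup>+ x. f a x \<partial>word_field p \<partial>measure_pmf p)"
    unfolding word_field_def
    by (intro nn_integral_PiM_component[where f = "\<lambda>a. \<integral>\<^sup>+ y. f a y \<partial>PiM UNIV (\<lambda>_. measure_pmf p)"]
        measure_pmf.prob_space_axioms) simp
  finally show ?thesis .
qed

text \<open>The subtrees below two different children read disjoint sets of words, so resampling all
  words that do not start with \<open>i\<close> separates the two factors.\<close>

lemma nn_integral_word_field_children:
  assumes f [measurable]: "f \<in> borel_measurable (word_field p)" and g [measurable]: "g \<in> borel_measurable (word_field p)"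
    and "i \<noteq> j"
  shows "(\<integral>\<^sup>+ x. f (\<lambda>u. x (i # u)) * g (\<lambda>u. x (j # u)) \<partial>word_field p) =
    (\<integral>\<^sup>+ x. f x \<partial>word_field p) * (\<integral>\<^sup>+ x. g x \<partial>word_field p)"
proof -
  let ?A = "range ((#) i)"
  note measurable_compose[OF measurable_word_field_child f, measurable]
    measurable_compose[OF measurable_word_field_child g, measurable]
  have "(\<integral>\<^sup>+ x. f (\<lambda>u. x (i # u)) * g (\<lambda>u. x (j # u)) \<partial>word_field p) =
    (\<integral>\<^sup>+ x. \<integral>\<^sup>+ y. f (\<lambda>u. x (i # u)) * g (\<lambda>u. y (j # u)) \<partial>word_field p \<partial>word_field p)"
    using \<open>i \<noteq> j\<close> by (subst nn_integral_word_field_mix[of _ p ?A]) (auto simp: image_iff)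
  also have "\<dots> = (\<integral>\<^sup>+ x. f (\<lambda>u. x (i # u)) \<partial>word_field p) * (\<integral>\<^sup>+ x. g (\<lambda>u. x (j # u)) \<partial>word_field p)"
    by (simp add: nn_integral_cmult nn_integral_multc)
  finally show ?thesis
    using nn_integral_word_field_child[OF f, of i] nn_integral_word_field_child[OF g, of j] by simp
qed

section \<open>One step of the walk and the moments of the offspring law\<close>

lemma nn_integral_srw_step:
  fixes s :: "int ^ 'd::finite"
  assumes "\<And>v. 0 \<le> f v"
  shows "(\<integral>\<^sup>+ e. ennreal (f (s + e)) \<partial>srw_step) = ennreal (step_avg f s)"
proof -
  let ?A = "range (\<lambda>i::'d. axis i (1::int))" and ?B = "range (\<lambda>i::'d. - axis i (1::int))"
  have inj: "inj (\<lambda>i::'d. axis i (1::int))" "inj (\<lambda>i::'d. - axis i (1::int))"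
    by (auto simp: inj_def axis_eq_axis)
  have neq: "axis i (1::int) \<noteq> - axis j 1" for i j :: 'd
  proof
    assume "axis i (1::int) = - axis j 1"
    then have "axis i (1::int) $ i = (- axis j 1) $ i" by simp
    then show False by (simp add: axis_def split: if_splits)
  qed
  have disj: "?A \<inter> ?B = {}" using neq by auto
  then have card: "card (?A \<union> ?B) = 2 * CARD('d)"
    using inj by (subst card_Un_disjoint) (simp_all add: card_image)
  have "(\<integral>\<^sup>+ e. ennreal (f (s + e)) \<partial>srw_step) = (\<Sum>e\<in>?A \<union> ?B. ennreal (f (s + e))) / card (?A \<union> ?B)"
    unfolding srw_step_def by (subst nn_integral_pmf_of_set) auto
  also have "(\<Sum>e\<in>?A \<union> ?B. ennreal (f (s + e))) = ennreal (\<Sum>e\<in>?A \<union> ?B. f (s + e))"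
    using assms by (simp add: sum_ennreal)
  also have "(\<Sum>e\<in>?A \<union> ?B. f (s + e)) = (\<Sum>e\<in>?A. f (s + e)) + (\<Sum>e\<in>?B. f (s + e))"
    using disj by (intro sum.union_disjoint) auto
  also have "\<dots> = (\<Sum>j\<in>UNIV. f (s + axis j 1) + f (s - axis j 1))"
    using inj by (simp add: sum.reindex sum.distrib)
  finally show ?thesis
    unfolding card step_avg_def
    by (simp add: divide_ennreal[symmetric] sum_nonneg assms ennreal_of_nat_eq_real_of_nat)
qed

lemma step_avg_nonneg: "(\<And>v. 0 \<le> f v) \<Longrightarrow> 0 \<le> step_avg f s"
  unfolding step_avg_def by (intro divide_nonneg_nonneg sum_nonneg) auto

lemma hit_prob_0: "hit_prob 0 s = (if s = 0 then 1 else 0)"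
  by (simp add: hit_prob_def)

lemma hit_prob_Suc: "hit_prob (Suc n) s = step_avg (hit_prob n) s"
  by (simp add: hit_prob_def)

lemma hit_prob_nonneg: "0 \<le> hit_prob n s"
  by (induction n arbitrary: s) (auto simp: hit_prob_0 hit_prob_Suc step_avg_nonneg)

lemma nn_integral_geometric_half:
  "(\<integral>\<^sup>+ k. of_nat k \<partial>geometric_pmf (1 / 2)) = (1::ennreal)"
proof -
  have "(\<integral>\<^sup>+ k. ennreal (real k) \<partial>geometric_pmf (1 / 2)) = ennreal (measure_pmf.expectation (geometric_pmf (1 / 2)) real)"
    by (intro nn_integral_eq_integral integrable_real_geometric_pmf) auto
  then show ?thesis
    by (simp add: expectation_geometric_pmf ennreal_of_nat_eq_real_of_nat)
qed

text \<open>This moment counts ordered pairs of distinct children, the places where two ancestral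
  lines separate. The partial sums have a closed form that increases to 2.\<close>

lemma nn_integral_geometric_half_factorial2:
  "(\<integral>\<^sup>+ k. of_nat (k * (k - 1)) \<partial>geometric_pmf (1 / 2)) \<le> (2::ennreal)"
proof -
  let ?g = "\<lambda>k. real (k * (k - 1)) / 2 ^ (k + 1)"
  have partial: "(\<Sum>k<n. ?g k) = 2 - ((real n)\<^sup>2 + real n + 2) / 2 ^ n" for n
  proof (induction n)
    case (Suc n)
    have "real (n * (n - 1)) = real n * real n - real n" by (cases n) (auto simp: algebra_simps)
    then have "(\<Sum>k<Suc n. ?g k) = 2 - ((real n)\<^sup>2 + real n + 2) / 2 ^ n + (real n * real n - real n) / 2 ^ (n + 1)"
      unfolding sum.lessThan_Suc Suc.IH by (simp only:)
    then show ?case by (simp only:) (simp add: field_simps power2_eq_square)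
  qed simp
  have "(\<integral>\<^sup>+ k. of_nat (k * (k - 1)) \<partial>geometric_pmf (1 / 2)) = (\<integral>\<^sup>+ k. ennreal (?g k) \<partial>count_space UNIV)"
    unfolding nn_integral_measure_pmf
    by (intro nn_integral_cong)
      (auto simp: ennreal_of_nat_eq_real_of_nat ennreal_mult'[symmetric] power_divide field_simps)
  also have "\<dots> = (\<Sum>k. ennreal (?g k))" by (rule nn_integral_count_space_nat)
  also have "\<dots> \<le> 2"
  proof (intro suminf_le_const summableI)
    fix n
    have "(\<Sum>k<n. ennreal (?g k)) = ennreal (\<Sum>k<n. ?g k)" by (intro sum_ennreal) auto
    also have "\<dots> \<le> ennreal 2" unfolding partial by (intro ennreal_leI) auto
    finally show "(\<Sum>k<n. ennreal (?g k)) \<le> 2" by simp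
  qed
  finally show ?thesis .
qed

section \<open>Generation sizes, visits to the origin and pairs of vertices\<close>

primrec gen_size :: "nat \<Rightarrow> (nat list \<Rightarrow> nat) \<Rightarrow> nat" where
  "gen_size 0 k = 1"
| "gen_size (Suc n) k = (\<Sum>i<k []. gen_size n (\<lambda>u. k (i # u)))"

text \<open>
  The vertices at height \<open>n\<close> mapped to \<open>0\<close> when the root is mapped to \<open>s\<close>.
\<close>

primrec visits :: "nat \<Rightarrow> 'v::ab_group_add \<Rightarrow> (nat list \<Rightarrow> nat) \<Rightarrow> (nat list \<Rightarrow> 'v) \<Rightarrow> nat" where
  "visits 0 s k x = (if s = 0 then 1 else 0)"
| "visits (Suc n) s k x = (\<Sum>i<k []. visits n (s + x [i]) (\<lambda>u. k (i # u)) (\<lambda>u. x (i # u)))"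

text \<open>
  Pairs of vertices \<open>u\<close>, \<open>v\<close> at heights \<open>n\<close> and \<open>n + l\<close>, weighted by \<open>U\<close> at the distance from \<open>v\<close> to
  their last common ancestor: given the walk up to \<open>u\<close>, this bounds the probability of a zero at \<open>v\<close>.
\<close>

primrec pair_weight :: "(nat \<Rightarrow> ennreal) \<Rightarrow> nat \<Rightarrow> nat \<Rightarrow> (nat list \<Rightarrow> nat) \<Rightarrow> ennreal" where
  "pair_weight U l 0 k = U l * of_nat (gen_size l k)"
| "pair_weight U l (Suc n) k = (\<Sum>i<k []. pair_weight U l n (\<lambda>u. k (i # u))) +
    U (Suc n + l) * (\<Sum>i<k []. \<Sum>j\<in>{..<k []} - {i}.
      of_nat (gen_size n (\<lambda>u. k (i # u))) * of_nat (gen_size (n + l) (\<lambda>u. k (j # u))))"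

lemma measurable_gen_size [measurable]:
  "gen_size n \<in> measurable (word_field p) (count_space UNIV)"
proof (induction n)
  case (Suc n)
  note measurable_compose[OF measurable_word_field_child Suc.IH, measurable]
  have "(\<lambda>k. \<Sum>i<m. gen_size n (\<lambda>u. k (i # u))) \<in> measurable (word_field p) (count_space UNIV)" for m
    by measurable
  then have "(\<lambda>k. \<Sum>i<k []. gen_size n (\<lambda>u. k (i # u))) \<in> measurable (word_field p) (count_space UNIV)"
    by (rule measurable_compose_countable) (rule measurable_word_field_component)
  then show ?case by simp
qed simp

lemma measurable_pair_weight [measurable]:
  "pair_weight U l n \<in> borel_measurable (word_field p)"
proof (induction n)
  case (Suc n)
  note measurable_compose[OF measurable_word_field_child Suc.IH, measurable]
    measurable_compose[OF measurable_word_field_child measurable_gen_size, measurable]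
  have "(\<lambda>k. (\<Sum>i<m. pair_weight U l n (\<lambda>u. k (i # u))) +
    U (Suc n + l) * (\<Sum>i<m. \<Sum>j\<in>{..<m} - {i}.
      of_nat (gen_size n (\<lambda>u. k (i # u))) * of_nat (gen_size (n + l) (\<lambda>u. k (j # u)))))
    \<in> borel_measurable (word_field p)" for m
    by measurable
  from measurable_compose_countable[OF this measurable_word_field_component[of "[]"]] show ?case by simp
qed simp

lemma measurable_add_countable:
  fixes f g :: "'a \<Rightarrow> 'v::{ab_group_add, countable}"
  assumes [measurable]: "f \<in> measurable M (count_space UNIV)" "g \<in> measurable M (count_space UNIV)"
  shows "(\<lambda>x. f x + g x) \<in> measurable M (count_space UNIV)"
  by (rule measurable_compose_countable[OF _ assms(1)], rule measurable_compose[OF assms(2)]) simp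

lemma measurable_visits:
  fixes s :: "'v::{ab_group_add, countable}"
  shows "(\<lambda>(k, x). visits n s k x) \<in> measurable (word_field p \<Otimes>\<^sub>M word_field q) (count_space UNIV)"
proof (induction n arbitrary: s)
  case (Suc n)
  have 1: "(\<lambda>z. visits n t (\<lambda>u. fst z (i # u)) (\<lambda>u. snd z (i # u)))
    \<in> measurable (word_field p \<Otimes>\<^sub>M word_field q) (count_space UNIV)" for i t
    using measurable_compose[OF measurable_Pair[OF
        measurable_compose[OF measurable_fst measurable_word_field_child[of i]]
        measurable_compose[OF measurable_snd measurable_word_field_child[of i]]] Suc.IH[of t]]
    by simp
  have 2: "(\<lambda>z. visits n (s + snd z [i]) (\<lambda>u. fst z (i # u)) (\<lambda>u. snd z (i # u)))
    \<in> measurable (word_field p \<Otimes>\<^sub>M word_field q) (count_space UNIV)" for i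
    by (intro measurable_compose_countable[OF 1] measurable_add_countable measurable_const
      measurable_compose[OF measurable_snd measurable_word_field_component]) simp
  have "(\<lambda>z. \<Sum>i<m. visits n (s + snd z [i]) (\<lambda>u. fst z (i # u)) (\<lambda>u. snd z (i # u)))
    \<in> measurable (word_field p \<Otimes>\<^sub>M word_field q) (count_space UNIV)" for m :: nat
    using 2 by measurable
  from measurable_compose_countable[OF this measurable_compose[OF measurable_fst measurable_word_field_component[of "[]"]]]
  show ?case by (simp add: case_prod_unfold)
qed (simp add: case_prod_unfold)

lemma measurable_visits_walk [measurable]:
  fixes s :: "'v::{ab_group_add, countable}"
  shows "visits n s k \<in> measurable (word_field q) (count_space UNIV)"
proof -
  have "(\<lambda>x. (k, x)) \<in> measurable (word_field q) (word_field (geometric_pmf (1 / 2)) \<Otimes>\<^sub>M word_field q)"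
    by (rule measurable_Pair1') (simp add: word_field_def space_PiM)
  from measurable_compose[OF this measurable_visits[of n s]] show ?thesis by simp
qed

lemma visits_cong:
  "(\<And>u. u \<noteq> [] \<Longrightarrow> x u = y u) \<Longrightarrow> visits n s k x = visits n s k y"
  by (cases n) auto

subsection \<open>Moments of the number of visits\<close>

abbreviation step_field :: "(nat list \<Rightarrow> int ^ 'd::finite) measure" where
  "step_field \<equiv> word_field srw_step"

text \<open>The step towards child \<open>i\<close> is stored at the root of the field seen from
  that child. The walk below the child never reads this label, hence the premise
  \<open>root\<close>, and so the step can be averaged separately.\<close>

lemma nn_integral_step_root:
  fixes f :: "int ^ 'd::finite \<Rightarrow> (nat list \<Rightarrow> int ^ 'd) \<Rightarrow> ennreal"
  assumes f: "\<And>t. f t \<in> borel_measurable step_field"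
    and root: "\<And>t x y. (\<And>u. u \<noteq> [] \<Longrightarrow> x u = y u) \<Longrightarrow> f t x = f t y"
  shows "(\<integral>\<^sup>+ x. f (s + x [i]) (\<lambda>u. x (i # u)) \<partial>step_field) =
    (\<integral>\<^sup>+ e. \<integral>\<^sup>+ x. f (s + e) x \<partial>step_field \<partial>srw_step)"
proof -
  have m: "(\<lambda>x. f (s + x []) x) \<in> borel_measurable step_field"
    by (rule measurable_compose_countable[OF f])
      (intro measurable_add_countable measurable_const measurable_word_field_component, simp)
  have "(\<integral>\<^sup>+ x. f (s + x [i]) (\<lambda>u. x (i # u)) \<partial>step_field) = (\<integral>\<^sup>+ x. f (s + x []) x \<partial>step_field)"
    using nn_integral_word_field_child[OF m, of i] by simp
  also have "\<dots> = (\<integral>\<^sup>+ e. \<integral>\<^sup>+ x. f (s + e) x \<partial>step_field \<partial>srw_step)"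
    by (rule nn_integral_word_field_root[where f = "\<lambda>e. f (s + e)"]) (auto intro: f root)
  finally show ?thesis .
qed

lemma measurable_visits_child [measurable]:
  fixes s :: "'v::{ab_group_add, countable}"
  shows "(\<lambda>x. visits n (s + x [i]) k (\<lambda>u. x (i # u))) \<in> measurable (word_field q) (count_space UNIV)"
  by (rule measurable_compose_countable[OF measurable_compose[OF measurable_word_field_child measurable_visits_walk]])
    (intro measurable_add_countable measurable_const measurable_word_field_component, simp)

text \<open>For a frozen tree the walk along every ancestral line is a simple random walk, so by
  linearity each vertex of generation \<open>n\<close> contributes the same probability.\<close>

lemma nn_integral_visits:
  fixes s :: "int ^ 'd::finite"
  shows "(\<integral>\<^sup>+ x. of_nat (visits n s k x) \<partial>step_field) = of_nat (gen_size n k) * ennreal (hit_prob n s)"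
proof (induction n arbitrary: s k)
  case 0
  interpret X: prob_space "step_field :: (nat list \<Rightarrow> int ^ 'd) measure" by (rule prob_space_word_field)
  show ?case by (simp add: hit_prob_0 X.emeasure_space_1)
next
  case (Suc n)
  have "(\<integral>\<^sup>+ x. of_nat (visits (Suc n) s k x) \<partial>step_field) =
    (\<Sum>i<k []. \<integral>\<^sup>+ x. of_nat (visits n (s + x [i]) (\<lambda>u. k (i # u)) (\<lambda>u. x (i # u))) \<partial>step_field)"
    by (simp add: nn_integral_sum)
  also have "\<dots> = (\<Sum>i<k []. of_nat (gen_size n (\<lambda>u. k (i # u))) * ennreal (hit_prob (Suc n) s))"
  proof (intro sum.cong refl)
    fix i
    have "(\<integral>\<^sup>+ x. of_nat (visits n (s + x [i]) (\<lambda>u. k (i # u)) (\<lambda>u. x (i # u))) \<partial>step_field) =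
      (\<integral>\<^sup>+ e. \<integral>\<^sup>+ x. of_nat (visits n (s + e) (\<lambda>u. k (i # u)) x) \<partial>step_field \<partial>srw_step)"
      by (rule nn_integral_step_root[where f = "\<lambda>t x. of_nat (visits n t (\<lambda>u. k (i # u)) x)"])
        (auto intro: arg_cong[OF visits_cong])
    also have "\<dots> = of_nat (gen_size n (\<lambda>u. k (i # u))) * ennreal (hit_prob (Suc n) s)"
      by (simp add: Suc.IH nn_integral_cmult nn_integral_srw_step hit_prob_nonneg hit_prob_Suc)
    finally show "(\<integral>\<^sup>+ x. of_nat (visits n (s + x [i]) (\<lambda>u. k (i # u)) (\<lambda>u. x (i # u))) \<partial>step_field) =
      of_nat (gen_size n (\<lambda>u. k (i # u))) * ennreal (hit_prob (Suc n) s)" .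
  qed
  finally show ?case by (simp add: sum_distrib_right)
qed

lemma sum_mult_sum_diag:
  fixes f g :: "'i \<Rightarrow> 'a::semiring_0"
  assumes "finite A"
  shows "(\<Sum>i\<in>A. f i) * (\<Sum>j\<in>A. g j) = (\<Sum>i\<in>A. f i * g i) + (\<Sum>i\<in>A. \<Sum>j\<in>A - {i}. f i * g j)"
  using assms by (simp add: sum_product sum.remove sum.distrib)

text \<open>Pairs of vertices are split according to whether they lie below the same child of the
  root. Those below the same child are handled by induction after averaging over the first step. For
  different children the two walks are independent; the probability for the higher generation is
  bounded by \<open>U\<close>, while the other one is kept exact so that the estimate stays
  proportional to the mean.\<close>

lemma nn_integral_visits_mult_le:
  fixes s :: "int ^ 'd::finite"
  assumes U: "\<And>n (s :: int ^ 'd). ennreal (hit_prob n s) \<le> U n"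
  shows "(\<integral>\<^sup>+ x. of_nat (visits n s k x) * of_nat (visits (n + l) s k x) \<partial>step_field)
    \<le> ennreal (hit_prob n s) * pair_weight U l n k"
proof (induction n arbitrary: s k)
  case 0
  show ?case
  proof (cases "s = 0")
    case True
    then have "(\<integral>\<^sup>+ x. of_nat (visits 0 s k x) * of_nat (visits (0 + l) s k x) \<partial>step_field) =
      of_nat (gen_size l k) * ennreal (hit_prob l s)"
      by (simp add: nn_integral_visits)
    also have "\<dots> \<le> of_nat (gen_size l k) * U l"
      by (intro mult_left_mono U) auto
    finally show ?thesis using True by (simp add: hit_prob_0 mult.commute)
  qed (simp add: hit_prob_0)
next
  case (Suc n)
  define kk where "kk i = (\<lambda>u. k (i # u))" for i
  define a where "a m i x = (of_nat (visits m (s + x [i]) (kk i) (\<lambda>u. x (i # u))) :: ennreal)" for m i x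
  have a_meas [measurable]: "a m i \<in> borel_measurable step_field" for m i
    unfolding a_def by measurable
  have a1: "(\<integral>\<^sup>+ x. a m i x \<partial>step_field) = of_nat (gen_size m (kk i)) * ennreal (hit_prob (Suc m) s)" for m i
  proof -
    have "(\<integral>\<^sup>+ x. a m i x \<partial>step_field) =
      (\<integral>\<^sup>+ e. \<integral>\<^sup>+ x. of_nat (visits m (s + e) (kk i) x) \<partial>step_field \<partial>srw_step)"
      unfolding a_def by (rule nn_integral_step_root[where f = "\<lambda>t x. of_nat (visits m t (kk i) x)"])
        (auto intro: arg_cong[OF visits_cong])
    then show ?thesis
      by (simp add: nn_integral_visits nn_integral_cmult nn_integral_srw_step hit_prob_nonneg hit_prob_Suc)
  qed
  have diag: "(\<integral>\<^sup>+ x. a n i x * a (n + l) i x \<partial>step_field) \<le> ennreal (hit_prob (Suc n) s) * pair_weight U l n (kk i)" for i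
  proof -
    have "(\<integral>\<^sup>+ x. a n i x * a (n + l) i x \<partial>step_field) =
      (\<integral>\<^sup>+ e. \<integral>\<^sup>+ x. of_nat (visits n (s + e) (kk i) x) * of_nat (visits (n + l) (s + e) (kk i) x) \<partial>step_field \<partial>srw_step)"
      unfolding a_def by (rule nn_integral_step_root[where
        f = "\<lambda>t x. of_nat (visits n t (kk i) x) * of_nat (visits (n + l) t (kk i) x)"])
        (auto intro!: arg_cong2[where f = "(*)"] arg_cong[OF visits_cong])
    also have "\<dots> \<le> (\<integral>\<^sup>+ e. ennreal (hit_prob n (s + e)) * pair_weight U l n (kk i) \<partial>srw_step)"
      by (intro nn_integral_mono Suc.IH)
    also have "\<dots> = ennreal (hit_prob (Suc n) s) * pair_weight U l n (kk i)"
      by (simp add: nn_integral_multc nn_integral_srw_step hit_prob_nonneg hit_prob_Suc)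
    finally show ?thesis .
  qed
  have off: "(\<integral>\<^sup>+ x. a n i x * a (n + l) j x \<partial>step_field) \<le> ennreal (hit_prob (Suc n) s) *
    (U (Suc n + l) * (of_nat (gen_size n (kk i)) * of_nat (gen_size (n + l) (kk j))))" if "i \<noteq> j" for i j
  proof -
    have m: "(\<lambda>x. of_nat (visits m (s + x []) (kk i) x) :: ennreal) \<in> borel_measurable step_field" for m i
      by (rule measurable_compose_countable[where f = "\<lambda>t x. of_nat (visits m t (kk i) x)",
          OF measurable_compose[OF measurable_visits_walk]], simp)
        (intro measurable_add_countable measurable_const measurable_word_field_component, simp)
    have "(\<integral>\<^sup>+ x. a n i x * a (n + l) j x \<partial>step_field) =
      (\<integral>\<^sup>+ x. a n i x \<partial>step_field) * (\<integral>\<^sup>+ x. a (n + l) j x \<partial>step_field)"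
      using nn_integral_word_field_children[OF m[of n i] m[of "n + l" j] that]
        nn_integral_word_field_child[OF m[of n i], of i] nn_integral_word_field_child[OF m[of "n + l" j], of j]
      unfolding a_def by simp
    also have "\<dots> = ennreal (hit_prob (Suc n) s) * (ennreal (hit_prob (Suc (n + l)) s) *
        (of_nat (gen_size n (kk i)) * of_nat (gen_size (n + l) (kk j))))"
      unfolding a1 by (simp add: mult_ac)
    also have "\<dots> \<le> ennreal (hit_prob (Suc n) s) *
        (U (Suc n + l) * (of_nat (gen_size n (kk i)) * of_nat (gen_size (n + l) (kk j))))"
      using U[of "Suc (n + l)" s] by (intro mult_left_mono mult_right_mono) auto
    finally show ?thesis .
  qed
  have "(\<integral>\<^sup>+ x. of_nat (visits (Suc n) s k x) * of_nat (visits (Suc n + l) s k x) \<partial>step_field) =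
    (\<integral>\<^sup>+ x. (\<Sum>i<k []. a n i x * a (n + l) i x) + (\<Sum>i<k []. \<Sum>j\<in>{..<k []} - {i}. a n i x * a (n + l) j x) \<partial>step_field)"
    by (subst sum_mult_sum_diag[symmetric]) (auto simp: a_def kk_def)
  also have "\<dots> = (\<Sum>i<k []. \<integral>\<^sup>+ x. a n i x * a (n + l) i x \<partial>step_field) +
    (\<Sum>i<k []. \<Sum>j\<in>{..<k []} - {i}. \<integral>\<^sup>+ x. a n i x * a (n + l) j x \<partial>step_field)"
    by (simp add: nn_integral_add nn_integral_sum)
  also have "\<dots> \<le> (\<Sum>i<k []. ennreal (hit_prob (Suc n) s) * pair_weight U l n (kk i)) +
    (\<Sum>i<k []. \<Sum>j\<in>{..<k []} - {i}. ennreal (hit_prob (Suc n) s) *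
    (U (Suc n + l) * (of_nat (gen_size n (kk i)) * of_nat (gen_size (n + l) (kk j)))))"
    by (intro add_mono sum_mono diag off) auto
  also have "\<dots> = ennreal (hit_prob (Suc n) s) * pair_weight U l (Suc n) k"
    by (simp add: kk_def sum_distrib_left distrib_left)
  finally show ?case .
qed

lemma nn_integral_gw_root:
  fixes f :: "nat \<Rightarrow> (nat list \<Rightarrow> nat) \<Rightarrow> ennreal"
  assumes f: "\<And>m. f m \<in> borel_measurable gw_space"
    and root: "\<And>m x y. (\<And>u. u \<noteq> [] \<Longrightarrow> x u = y u) \<Longrightarrow> f m x = f m y"
  shows "(\<integral>\<^sup>+ k. f (k []) k \<partial>gw_space) = (\<integral>\<^sup>+ m. \<integral>\<^sup>+ k. f m k \<partial>gw_space \<partial>geometric_pmf (1 / 2))"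
  using assms unfolding gw_space_eq by (rule nn_integral_word_field_root)

text \<open>Criticality enters here: the children carry independent copies of the tree, and their
  mean number is 1.\<close>

lemma nn_integral_gw_children:
  assumes f: "\<And>i. f \<in> borel_measurable gw_space"
  shows "(\<integral>\<^sup>+ k. (\<Sum>i<k []. f (\<lambda>u. k (i # u))) \<partial>gw_space) = (\<integral>\<^sup>+ k. f k \<partial>gw_space)"
proof -
  have m: "(\<lambda>k. f (\<lambda>u. k (i # u))) \<in> borel_measurable gw_space" for i
    using f unfolding gw_space_eq by (rule measurable_compose[OF measurable_word_field_child])
  have c: "(\<integral>\<^sup>+ k. f (\<lambda>u. k (i # u)) \<partial>gw_space) = (\<integral>\<^sup>+ k. f k \<partial>gw_space)" for i
    using f unfolding gw_space_eq by (rule nn_integral_word_field_child)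
  have "(\<integral>\<^sup>+ k. (\<Sum>i<k []. f (\<lambda>u. k (i # u))) \<partial>gw_space) =
    (\<integral>\<^sup>+ m. \<integral>\<^sup>+ k. (\<Sum>i<m. f (\<lambda>u. k (i # u))) \<partial>gw_space \<partial>geometric_pmf (1 / 2))"
    by (rule nn_integral_gw_root) (auto intro!: borel_measurable_sum m)
  also have "\<dots> = (\<integral>\<^sup>+ m. of_nat m * (\<integral>\<^sup>+ k. f k \<partial>gw_space) \<partial>geometric_pmf (1 / 2))"
    by (simp add: nn_integral_sum m c)
  also have "\<dots> = (\<integral>\<^sup>+ k. f k \<partial>gw_space)"
    by (simp add: nn_integral_multc nn_integral_geometric_half)
  finally show ?thesis .
qed

lemma measurable_gen_size_gw: "gen_size n \<in> measurable gw_space (count_space UNIV)"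
  unfolding gw_space_eq by measurable

lemma nn_integral_gen_size: "(\<integral>\<^sup>+ k. of_nat (gen_size n k) \<partial>gw_space) = 1"
proof (induction n)
  case 0
  interpret prob_space gw_space by (rule prob_space_gw_space)
  show ?case by (simp add: emeasure_space_1)
next
  case (Suc n)
  have "(\<integral>\<^sup>+ k. of_nat (gen_size (Suc n) k) \<partial>gw_space) =
    (\<integral>\<^sup>+ k. (\<Sum>i<k []. of_nat (gen_size n (\<lambda>u. k (i # u)))) \<partial>gw_space)"
    by simp
  also have "\<dots> = (\<integral>\<^sup>+ k. of_nat (gen_size n k) \<partial>gw_space)"
    by (rule nn_integral_gw_children[where f = "\<lambda>k. of_nat (gen_size n k)"])
      (rule measurable_compose[OF measurable_gen_size_gw], simp)
  finally show ?case using Suc.IH by simp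
qed

text \<open>By criticality the pairs below a common child have the same mean as one generation
  earlier. The pairs that separate at the root add \<open>U (Suc n + l)\<close> times the second
  factorial moment, because the two generation sizes are independent of mean 1. The base case alone
  would allow the constant 1.\<close>

lemma nn_integral_pair_weight_le:
  "(\<integral>\<^sup>+ k. pair_weight U l n k \<partial>gw_space) \<le> 2 * (\<Sum>j\<le>n. U (j + l))"
proof (induction n)
  case 0
  have "(\<integral>\<^sup>+ k. pair_weight U l 0 k \<partial>gw_space) = U l"
    by (simp add: nn_integral_cmult nn_integral_gen_size measurable_compose[OF measurable_gen_size_gw])
  also have "\<dots> \<le> 2 * U l" by (simp add: mult_2)
  finally show ?case by simp
next
  case (Suc n)
  let ?off = "\<lambda>m k. \<Sum>i<m. \<Sum>j\<in>{..<m} - {i}.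
      of_nat (gen_size n (\<lambda>u. k (i # u))) * of_nat (gen_size (n + l) (\<lambda>u. k (j # u))) :: ennreal"
  have g [measurable]: "(\<lambda>k. of_nat (gen_size n (\<lambda>u. k (i # u))) :: ennreal) \<in> borel_measurable gw_space" for n i
    unfolding gw_space_eq
    by (rule measurable_compose[OF measurable_compose[OF measurable_word_field_child measurable_gen_size]]) simp
  have off_meas [measurable]: "?off m \<in> borel_measurable gw_space" for m by measurable
  have "(\<integral>\<^sup>+ k. ?off (k []) k \<partial>gw_space) = (\<integral>\<^sup>+ m. \<integral>\<^sup>+ k. ?off m k \<partial>gw_space \<partial>geometric_pmf (1 / 2))"
    by (rule nn_integral_gw_root) auto
  also have "\<dots> = (\<integral>\<^sup>+ m. of_nat (m * (m - 1)) \<partial>geometric_pmf (1 / 2))"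
  proof (intro nn_integral_cong)
    fix m
    have 1: "(\<integral>\<^sup>+ k. of_nat (gen_size n (\<lambda>u. k (i # u))) * of_nat (gen_size (n + l) (\<lambda>u. k (j # u))) \<partial>gw_space) = (1::ennreal)"
      if "i \<noteq> j" for i j
    proof -
      have "(\<integral>\<^sup>+ k. of_nat (gen_size n (\<lambda>u. k (i # u))) * of_nat (gen_size (n + l) (\<lambda>u. k (j # u))) \<partial>gw_space) =
        (\<integral>\<^sup>+ k. of_nat (gen_size n k) \<partial>gw_space) * (\<integral>\<^sup>+ k. of_nat (gen_size (n + l) k) \<partial>gw_space)"
        using that unfolding gw_space_eq
        by (intro nn_integral_word_field_children[where f = "\<lambda>k. of_nat (gen_size n k)" and g = "\<lambda>k. of_nat (gen_size (n + l) k)"])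
          measurable
      then show ?thesis by (simp add: nn_integral_gen_size)
    qed
    have "(\<integral>\<^sup>+ k. ?off m k \<partial>gw_space) = (\<Sum>i<m. \<Sum>j\<in>{..<m} - {i}. \<integral>\<^sup>+ k.
      of_nat (gen_size n (\<lambda>u. k (i # u))) * of_nat (gen_size (n + l) (\<lambda>u. k (j # u))) \<partial>gw_space)"
      by (simp add: nn_integral_sum)
    also have "\<dots> = (\<Sum>i<m. \<Sum>j\<in>{..<m} - {i}. 1)"
      by (intro sum.cong refl 1) auto
    also have "\<dots> = of_nat (m * (m - 1))"
      by simp
    finally show "(\<integral>\<^sup>+ k. ?off m k \<partial>gw_space) = of_nat (m * (m - 1))" .
  qed
  finally have off: "(\<integral>\<^sup>+ k. ?off (k []) k \<partial>gw_space) \<le> 2"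
    using nn_integral_geometric_half_factorial2 by simp
  have pw: "pair_weight U l n \<in> borel_measurable gw_space"
    unfolding gw_space_eq by measurable
  have pwc [measurable]: "(\<lambda>k. \<Sum>i<k []. pair_weight U l n (\<lambda>u. k (i # u))) \<in> borel_measurable gw_space"
    unfolding gw_space_eq
    by (rule measurable_compose_countable[OF _ measurable_word_field_component], rule borel_measurable_sum)
      (rule measurable_compose[OF measurable_word_field_child measurable_pair_weight])
  have offc [measurable]: "(\<lambda>k. ?off (k []) k) \<in> borel_measurable gw_space"
    by (rule measurable_compose_countable[OF off_meas])
      (use measurable_word_field_component in \<open>simp add: gw_space_eq\<close>)
  have "(\<integral>\<^sup>+ k. pair_weight U l (Suc n) k \<partial>gw_space) =
    (\<integral>\<^sup>+ k. (\<Sum>i<k []. pair_weight U l n (\<lambda>u. k (i # u))) \<partial>gw_space) + U (Suc n + l) * (\<integral>\<^sup>+ k. ?off (k []) k \<partial>gw_space)"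
    unfolding pair_weight.simps
    by (subst nn_integral_add) (auto intro!: nn_integral_cmult)
  also have "\<dots> \<le> 2 * (\<Sum>j\<le>n. U (j + l)) + U (Suc n + l) * 2"
    using Suc.IH off nn_integral_gw_children[OF pw] by (intro add_mono mult_left_mono) auto
  finally show ?case by (simp add: distrib_left mult.commute)
qed

subsection \<open>Hitting probabilities of a single tree\<close>

text \<open>By symmetry twice the pairs with \<open>n \<le> m\<close> dominate the square, and
  \<open>l = m - n\<close> is then less than \<open>T\<close>.\<close>

lemma sum_mult_sum_le_shifts:
  fixes a :: "nat \<Rightarrow> nat"
  assumes "I \<subseteq> {..<T}"
  shows "(\<Sum>n\<in>I. a n) * (\<Sum>n\<in>I. a n) \<le> 2 * (\<Sum>n\<in>I. \<Sum>l<T. a n * a (n + l))"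
proof -
  have fin: "finite I" using assms finite_subset by blast
  let ?S = "\<Sum>n\<in>I. \<Sum>m\<in>I. if n \<le> m then a n * a m else 0"
  have "(\<Sum>n\<in>I. a n) * (\<Sum>n\<in>I. a n) = (\<Sum>n\<in>I. \<Sum>m\<in>I. a n * a m)"
    by (rule sum_product)
  also have "\<dots> \<le> (\<Sum>n\<in>I. \<Sum>m\<in>I. (if n \<le> m then a n * a m else 0) + (if m \<le> n then a m * a n else 0))"
    by (intro sum_mono) auto
  also have "\<dots> = ?S + (\<Sum>n\<in>I. \<Sum>m\<in>I. if m \<le> n then a m * a n else 0)"
    by (simp add: sum.distrib)
  also have "(\<Sum>n\<in>I. \<Sum>m\<in>I. if m \<le> n then a m * a n else 0) = ?S"
    by (rule sum.swap)
  also have "?S \<le> (\<Sum>n\<in>I. \<Sum>l<T. a n * a (n + l))"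
  proof (intro sum_mono)
    fix n
    have "(\<Sum>m\<in>I. if n \<le> m then a n * a m else 0) = (\<Sum>m\<in>{m \<in> I. n \<le> m}. a n * a m)"
      using fin by (simp add: sum.inter_filter)
    also have "\<dots> \<le> (\<Sum>m\<in>(+) n ` {..<T}. a n * a m)"
    proof (intro sum_mono2)
      show "{m \<in> I. n \<le> m} \<subseteq> (+) n ` {..<T}"
      proof
        fix m assume "m \<in> {m \<in> I. n \<le> m}"
        then have "m = n + (m - n)" "m - n \<in> {..<T}" using assms by auto
        then show "m \<in> (+) n ` {..<T}" by blast
      qed
    qed auto
    also have "\<dots> = (\<Sum>l<T. a n * a (n + l))"
      by (simp add: sum.reindex)
    finally show "(\<Sum>m\<in>I. if n \<le> m then a n * a m else 0) \<le> (\<Sum>l<T. a n * a (n + l))" .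
  qed
  finally show ?thesis by simp
qed

text \<open>A value \<open>q = l + j\<close> has \<open>q + 1\<close> representations in all, and
  \<open>n < T\<close> forces \<open>q < 2 * T\<close>.\<close>

lemma sum_antidiagonal_le:
  fixes U :: "nat \<Rightarrow> real"
  assumes U: "\<And>n. 0 \<le> U n" and "n < T"
  shows "(\<Sum>l<T. \<Sum>j\<le>n. U (j + l)) \<le> (\<Sum>q<2 * T. real (Suc q) * U q)"
proof -
  have "(\<Sum>l<T. \<Sum>j\<le>n. U (j + l)) = (\<Sum>(l, j)\<in>{..<T} \<times> {..n}. U (l + j))"
    by (simp add: sum.cartesian_product add.commute)
  also have "\<dots> \<le> (\<Sum>(l, j)\<in>{(l, j). l + j < 2 * T}. U (l + j))"
  proof (intro sum_mono2)
    show "finite {(l, j). l + j < 2 * T}"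
      by (rule finite_subset[of _ "{..<2 * T} \<times> {..<2 * T}"]) auto
  qed (use assms in auto)
  also have "\<dots> = (\<Sum>q<2 * T. real (Suc q) * U q)"
    by (subst sum.triangle_reindex) (simp add: algebra_simps)
  finally show ?thesis .
qed

lemma measurable_visits_gw:
  fixes s :: "int ^ 'd::finite"
  shows "(\<lambda>(k, x). visits n s k x) \<in> measurable (gw_space \<Otimes>\<^sub>M step_field) (count_space UNIV)"
  unfolding gw_space_eq by (rule measurable_visits)

definition miss_prob :: "nat set \<Rightarrow> int ^ 'd::finite \<Rightarrow> ennreal" where
  "miss_prob I s = (\<integral>\<^sup>+ k. \<integral>\<^sup>+ x. of_bool (\<forall>n\<in>I. visits n s k x = 0) \<partial>step_field \<partial>gw_space)"

text \<open>
  Integrate \<open>(1 - c N)\<^sup>2 \<ge> 0\<close> over \<open>N \<ge> 1\<close>, where \<open>N\<close> is the number of visits and \<open>c = 1 / (4 Y)\<close>: the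
  second moment of \<open>N\<close> is at most \<open>4 Y\<close> times its mean.
\<close>

lemma miss_prob_le:
  fixes s :: "int ^ 'd::finite"
  assumes I: "I \<subseteq> {..<T}"
    and U: "\<And>n (s :: int ^ 'd). hit_prob n s \<le> U n"
    and Y: "(\<Sum>q<2 * T. real (Suc q) * U q) \<le> Y" "0 < Y"
  shows "miss_prob I s \<le> ennreal (1 - (\<Sum>n\<in>I. hit_prob n s) / (4 * Y))"
proof -
  interpret X: prob_space "step_field :: (nat list \<Rightarrow> int ^ 'd) measure" by (rule prob_space_word_field)
  interpret G: prob_space gw_space by (rule prob_space_gw_space)
  interpret P: pair_prob_space gw_space "step_field :: (nat list \<Rightarrow> int ^ 'd) measure" ..
  let ?P = "gw_space \<Otimes>\<^sub>M (step_field :: (nat list \<Rightarrow> int ^ 'd) measure)"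
  define v where "v n z = visits n s (fst z) (snd z)" for n and z :: "(nat list \<Rightarrow> nat) \<times> (nat list \<Rightarrow> int ^ 'd)"
  have v [measurable]: "v n \<in> measurable ?P (count_space UNIV)" for n
    using measurable_visits_gw[of n s] unfolding v_def by (simp add: case_prod_unfold)
  define N where "N z = (\<Sum>n\<in>I. v n z)" for z
  have N [measurable]: "N \<in> measurable ?P (count_space UNIV)" unfolding N_def by measurable
  have fin: "finite I" using I finite_subset by blast
  have U0: "0 \<le> U n" for n using order_trans[OF hit_prob_nonneg U[of n 0]] .
  define h where "h = (\<Sum>n\<in>I. hit_prob n s)"
  have h0: "0 \<le> h" unfolding h_def by (intro sum_nonneg hit_prob_nonneg)
  have m1: "(\<integral>\<^sup>+ z. of_nat (N z) \<partial>?P) = ennreal h"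
  proof -
    have "(\<integral>\<^sup>+ z. of_nat (N z) \<partial>?P) = (\<Sum>n\<in>I. \<integral>\<^sup>+ z. of_nat (v n z) \<partial>?P)"
      unfolding N_def by (simp add: nn_integral_sum)
    also have "\<dots> = (\<Sum>n\<in>I. ennreal (hit_prob n s))"
    proof (intro sum.cong refl)
      fix n
      have "(\<integral>\<^sup>+ z. of_nat (v n z) \<partial>?P) = (\<integral>\<^sup>+ k. \<integral>\<^sup>+ x. of_nat (v n (k, x)) \<partial>step_field \<partial>gw_space)"
        by (rule X.nn_integral_fst[symmetric]) measurable
      also have "\<dots> = ennreal (hit_prob n s)"
        by (simp add: v_def nn_integral_visits nn_integral_multc nn_integral_gen_size
            measurable_compose[OF measurable_gen_size_gw])
      finally show "(\<integral>\<^sup>+ z. of_nat (v n z) \<partial>?P) = ennreal (hit_prob n s)" .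
    qed
    finally show ?thesis by (simp add: h_def sum_ennreal hit_prob_nonneg)
  qed
  have m2: "(\<integral>\<^sup>+ z. of_nat (N z * N z) \<partial>?P) \<le> ennreal (4 * Y * h)"
  proof -
    have "(\<integral>\<^sup>+ z. of_nat (N z * N z) \<partial>?P) \<le>
      (\<integral>\<^sup>+ z. of_nat (2 * (\<Sum>n\<in>I. \<Sum>l<T. v n z * v (n + l) z)) \<partial>?P)"
      unfolding N_def by (intro nn_integral_mono of_nat_mono sum_mult_sum_le_shifts I)
    also have "\<dots> = 2 * (\<Sum>n\<in>I. \<Sum>l<T. \<integral>\<^sup>+ z. of_nat (v n z) * of_nat (v (n + l) z) \<partial>?P)"
      by (simp add: nn_integral_sum nn_integral_cmult)
    also have "\<dots> \<le> 2 * (\<Sum>n\<in>I. \<Sum>l<T. ennreal (hit_prob n s * (2 * (\<Sum>j\<le>n. U (j + l)))))"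
    proof (intro mult_left_mono sum_mono)
      fix n l
      have "(\<integral>\<^sup>+ z. of_nat (v n z) * of_nat (v (n + l) z) \<partial>?P) =
        (\<integral>\<^sup>+ k. \<integral>\<^sup>+ x. of_nat (v n (k, x)) * of_nat (v (n + l) (k, x)) \<partial>step_field \<partial>gw_space)"
        by (rule X.nn_integral_fst[symmetric]) measurable
      also have "\<dots> \<le> (\<integral>\<^sup>+ k. ennreal (hit_prob n s) * pair_weight (\<lambda>n. ennreal (U n)) l n k \<partial>gw_space)"
        unfolding v_def fst_conv snd_conv
        by (intro nn_integral_mono nn_integral_visits_mult_le ennreal_leI U)
      also have "\<dots> = ennreal (hit_prob n s) * (\<integral>\<^sup>+ k. pair_weight (\<lambda>n. ennreal (U n)) l n k \<partial>gw_space)"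
        unfolding gw_space_eq by (rule nn_integral_cmult) measurable
      also have "\<dots> \<le> ennreal (hit_prob n s) * (2 * (\<Sum>j\<le>n. ennreal (U (j + l))))"
        by (intro mult_left_mono nn_integral_pair_weight_le) simp
      also have "\<dots> = ennreal (hit_prob n s * (2 * (\<Sum>j\<le>n. U (j + l))))"
        by (simp add: sum_ennreal U0 sum_nonneg ennreal_mult hit_prob_nonneg)
      finally show "(\<integral>\<^sup>+ z. of_nat (v n z) * of_nat (v (n + l) z) \<partial>?P) \<le>
        ennreal (hit_prob n s * (2 * (\<Sum>j\<le>n. U (j + l))))" .
    qed simp
    also have "\<dots> = ennreal (2 * (\<Sum>n\<in>I. \<Sum>l<T. hit_prob n s * (2 * (\<Sum>j\<le>n. U (j + l)))))"
    proof -
      have two: "2 * (\<Sum>n\<in>I. \<Sum>l<T. ennreal (X n l)) = ennreal (2 * (\<Sum>n\<in>I. \<Sum>l<T. X n l))"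
        if "\<And>n l. 0 \<le> X n l" for X
        using that by (simp add: sum_ennreal sum_nonneg ennreal_mult)
      show ?thesis by (intro two mult_nonneg_nonneg hit_prob_nonneg sum_nonneg U0) simp
    qed
    \<comment> \<open>One factor 2 comes from ordering the pairs, the other from
      \<open>nn_integral_pair_weight_le\<close>.\<close>
    also have "2 * (\<Sum>n\<in>I. \<Sum>l<T. hit_prob n s * (2 * (\<Sum>j\<le>n. U (j + l)))) =
      4 * (\<Sum>n\<in>I. hit_prob n s * (\<Sum>l<T. \<Sum>j\<le>n. U (j + l)))"
      by (simp add: sum_distrib_left mult_ac)
    also have "\<dots> \<le> 4 * (\<Sum>n\<in>I. hit_prob n s * Y)"
      using I order_trans[OF sum_antidiagonal_le[OF U0] Y(1)]
      by (intro mult_left_mono sum_mono hit_prob_nonneg) auto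
    also have "\<dots> = 4 * Y * h" by (simp add: h_def sum_distrib_right[symmetric])
    finally show ?thesis by (simp add: ennreal_leI)
  qed
  define c where "c = 1 / (4 * Y)"
  have c: "0 < c" "c * (4 * Y) = 1" using Y(2) by (auto simp: c_def)
  \<comment> \<open>For \<open>N z = 0\<close> both sides equal 1; otherwise this is the square,
    rearranged so that no subtraction occurs in \<open>ennreal\<close>.\<close>
  have pt: "of_bool (N z = 0) + ennreal (2 * c) * of_nat (N z) \<le> 1 + ennreal (c * c) * of_nat (N z * N z)" for z
  proof -
    have "of_bool (N z = 0) + 2 * c * real (N z) \<le> 1 + c * c * real (N z * N z)"
      using sum_squares_ge_zero[of "1 - c * real (N z)" 0] by (auto simp: algebra_simps)
    then have "ennreal (of_bool (N z = 0) + 2 * c * real (N z)) \<le> ennreal (1 + c * c * real (N z * N z))"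
      by (rule ennreal_leI)
    then show ?thesis
      using c by (cases "N z = 0") (simp_all add: ennreal_of_nat_eq_real_of_nat ennreal_mult del: of_nat_mult)
  qed
  let ?r = "\<integral>\<^sup>+ z. of_bool (N z = 0) \<partial>?P"
  have "?r + ennreal (2 * c * h) = ?r + ennreal (2 * c) * (\<integral>\<^sup>+ z. of_nat (N z) \<partial>?P)"
    using c h0 by (simp add: m1 ennreal_mult)
  also have "\<dots> = (\<integral>\<^sup>+ z. of_bool (N z = 0) + ennreal (2 * c) * of_nat (N z) \<partial>?P)"
    by (simp add: nn_integral_add nn_integral_cmult)
  also have "\<dots> \<le> (\<integral>\<^sup>+ z. 1 + ennreal (c * c) * of_nat (N z * N z) \<partial>?P)"
    by (intro nn_integral_mono pt)
  also have "\<dots> = 1 + ennreal (c * c) * (\<integral>\<^sup>+ z. of_nat (N z * N z) \<partial>?P)"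
    by (simp add: nn_integral_add nn_integral_cmult P.emeasure_space_1 del: of_nat_mult)
  also have "\<dots> \<le> 1 + ennreal (c * c) * ennreal (4 * Y * h)"
    by (intro add_left_mono mult_left_mono m2) simp
  also have "\<dots> = 1 + ennreal (c * h)"
  proof -
    have "c * c * (4 * Y * h) = c * h" using c(2) by algebra
    then show ?thesis using c(1) by (metis ennreal_mult' less_eq_real_def mult_nonneg_nonneg)
  qed
  finally have r: "?r + ennreal (2 * c * h) \<le> ennreal (1 + c * h)"
    using c h0 by (simp add: ennreal_plus)
  have "miss_prob I s = (\<integral>\<^sup>+ k. \<integral>\<^sup>+ x. of_bool (N (k, x) = 0) \<partial>step_field \<partial>gw_space)"
    unfolding miss_prob_def N_def v_def using fin by (intro nn_integral_cong arg_cong[where f = of_bool]) auto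
  also have "\<dots> = ?r"
    by (rule X.nn_integral_fst) measurable
  finally have r': "miss_prob I s = ?r" .
  have "miss_prob I s \<le> ennreal (1 + c * h) - ennreal (2 * c * h)"
    unfolding r' using r by (metis add.commute ennreal_le_minus_iff ennreal_less_top less_top_ennreal ennreal_minus_le_iff ennreal_neq_top)
  also have "\<dots> = ennreal (1 - h / (4 * Y))"
    using c(1) h0 by (subst ennreal_minus) (auto simp: c_def)
  finally show ?thesis by (simp add: h_def)
qed

subsection \<open>Exploration along the spine\<close>

lemma Cons_in_gw_tree_iff: "i # u \<in> gw_tree k \<longleftrightarrow> i < k [] \<and> u \<in> gw_tree (\<lambda>w. k (i # w))"
proof -
  have "(\<forall>j<length (i # u). (i # u) ! j < k (take j (i # u))) \<longleftrightarrow>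
    i < k [] \<and> (\<forall>j<length u. u ! j < k (i # take j u))"
    by (simp add: All_less_Suc2)
  then show ?thesis by (simp add: gw_tree_def)
qed

lemma tree_walk_Nil [simp]: "tree_walk x [] = 0"
  by (simp add: tree_walk_def)

lemma tree_walk_Cons: "tree_walk x (i # u) = x [i] + tree_walk (\<lambda>w. x (i # w)) u"
proof -
  have "tree_walk x (i # u) = (\<Sum>j=Suc 0..Suc (length u). x (take j (i # u)))"
    by (simp add: tree_walk_def)
  also have "\<dots> = x (take 1 (i # u)) + (\<Sum>j=Suc 1..Suc (length u). x (take j (i # u)))"
    by (subst sum.atLeast_Suc_atMost) simp_all
  also have "(\<Sum>j=Suc 1..Suc (length u). x (take j (i # u))) = tree_walk (\<lambda>w. x (i # w)) u"
    unfolding sum.shift_bounds_cl_Suc_ivl by (simp add: tree_walk_def)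
  finally show ?thesis by simp
qed

lemma visits_nonzeroE:
  assumes "visits n s k x \<noteq> 0"
  obtains u where "u \<in> gw_tree k" "length u = n" "s + tree_walk x u = 0"
  using assms
proof (induction n arbitrary: s k x thesis)
  case 0
  from "0.prems"(2) have "s = 0" by (simp split: if_splits)
  then show ?case by (intro "0.prems"(1)[of "[]"]) auto
next
  case (Suc n)
  from Suc.prems(2) obtain i where i: "i < k []" "visits n (s + x [i]) (\<lambda>u. k (i # u)) (\<lambda>u. x (i # u)) \<noteq> 0"
    by (auto simp: sum_eq_0_iff)
  from Suc.IH[OF _ i(2)] obtain u where "u \<in> gw_tree (\<lambda>u. k (i # u))" "length u = n"
    "s + x [i] + tree_walk (\<lambda>u. x (i # u)) u = 0" by blast
  with i(1) show ?case
    by (intro Suc.prems(1)[of "i # u"]) (auto simp: Cons_in_gw_tree_iff tree_walk_Cons add_ac)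
qed

text \<open>Words whose first letter is at least \<open>k []\<close> belong to the continuation of
  the spine or to the right tree. The left tree does not see them, which makes it independent of the
  rest of the exploration.\<close>

lemma visits_cong_tree:
  "(\<And>i u. i < k [] \<Longrightarrow> x (i # u) = y (i # u)) \<Longrightarrow> visits n s k x = visits n s k y"
  by (cases n) auto

text \<open>
  For \<open>j < m\<close>, the left tree at the \<open>j\<close>-th spine vertex has no zero at a height in \<open>I j\<close>.
\<close>

primrec spine_miss :: "nat \<Rightarrow> (nat \<Rightarrow> nat set) \<Rightarrow> 'v::ab_group_add \<Rightarrow> spine_config \<Rightarrow> (nat list \<Rightarrow> 'v) \<Rightarrow> bool" where
  "spine_miss 0 I s \<omega> x = True"
| "spine_miss (Suc m) I s \<omega> x \<longleftrightarrow> (\<forall>n\<in>I 0. visits n s (fst (\<omega> 0)) x = 0) \<and>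
    spine_miss m (\<lambda>j. I (Suc j)) (s + x [fst (\<omega> 0) []]) (\<lambda>j. \<omega> (Suc j)) (\<lambda>u. x (fst (\<omega> 0) [] # u))"

text \<open>Peels off the first spine vertex, as the recursion of \<open>spine_miss\<close> does,
  whereas \<open>spine_Suc\<close> appends the last one.\<close>

lemma spine_Cons: "spine \<omega> (Suc n) = fst (\<omega> 0) [] # spine (\<lambda>j. \<omega> (Suc j)) n"
  by (simp add: spine_def upt_conv_Cons map_Suc_upt[symmetric] o_def del: upt_Suc)

lemma not_spine_missE:
  assumes "\<not> spine_miss m I s \<omega> x"
  obtains j n u where "j < m" "n \<in> I j" "u \<in> gw_tree (fst (\<omega> j))" "length u = n"
    "s + tree_walk x (spine \<omega> j @ u) = 0"
  using assms
proof (induction m arbitrary: I s \<omega> x thesis)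
  case 0
  then show ?case by simp
next
  case (Suc m)
  show ?case
  proof (cases "\<forall>n\<in>I 0. visits n s (fst (\<omega> 0)) x = 0")
    case False
    then obtain n where n: "n \<in> I 0" "visits n s (fst (\<omega> 0)) x \<noteq> 0" by blast
    from n(2) obtain u where "u \<in> gw_tree (fst (\<omega> 0))" "length u = n" "s + tree_walk x u = 0"
      by (rule visits_nonzeroE)
    with n(1) show ?thesis by (intro Suc.prems(1)[of 0 n u]) auto
  next
    case True
    with Suc.prems(2) have "\<not> spine_miss m (\<lambda>j. I (Suc j)) (s + x [fst (\<omega> 0) []]) (\<lambda>j. \<omega> (Suc j))
      (\<lambda>u. x (fst (\<omega> 0) [] # u))" by simp
    from Suc.IH[OF _ this] obtain j n u where "j < m" "n \<in> I (Suc j)" "u \<in> gw_tree (fst (\<omega> (Suc j)))"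
      "length u = n" "s + x [fst (\<omega> 0) []] + tree_walk (\<lambda>u. x (fst (\<omega> 0) [] # u)) (spine (\<lambda>j. \<omega> (Suc j)) j @ u) = 0"
      by blast
    then show ?thesis
      by (intro Suc.prems(1)[of "Suc j" n u]) (auto simp: spine_Cons tree_walk_Cons add_ac)
  qed
qed

lemma measurable_Ball_countable:
  fixes I :: "'i::countable set"
  assumes "\<And>i. Measurable.pred M (P i)"
  shows "Measurable.pred M (\<lambda>z. \<forall>i\<in>I. P i z)"
  unfolding Ball_def by (intro pred_intros_countable pred_intros_logic assms) simp

lemma measurable_T_inf_space_shift: "(\<lambda>\<omega> j. \<omega> (Suc j)) \<in> measurable T_inf_space T_inf_space"
  unfolding T_inf_space_def by (rule measurable_PiM_reindex)

lemma measurable_T_inf_space_left: "(\<lambda>\<omega>. fst (\<omega> n)) \<in> measurable T_inf_space gw_space"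
  unfolding T_inf_space_def by (rule measurable_compose[where f = "\<lambda>\<omega>. \<omega> n", OF _ measurable_fst]) (rule measurable_component_singleton, simp)

lemma measurable_T_inf_space_right: "(\<lambda>\<omega>. snd (\<omega> n)) \<in> measurable T_inf_space gw_space"
  unfolding T_inf_space_def by (rule measurable_compose[where f = "\<lambda>\<omega>. \<omega> n", OF _ measurable_snd]) (rule measurable_component_singleton, simp)

lemma measurable_gw_component: "(\<lambda>k. k u) \<in> measurable gw_space (count_space UNIV)"
  unfolding gw_space_eq by (rule measurable_word_field_component)

lemma measurable_spine_miss:
  fixes s :: "int ^ 'd::finite"
  shows "(\<lambda>z. spine_miss m I s (fst z) (snd z)) \<in> measurable (T_inf_space \<Otimes>\<^sub>M step_field) (count_space UNIV)"
proof (induction m arbitrary: I s)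
  case 0
  show ?case by simp
next
  case (Suc m)
  let ?P = "T_inf_space \<Otimes>\<^sub>M (step_field :: (nat list \<Rightarrow> int ^ 'd) measure)"
  have left: "(\<lambda>z. fst (fst z 0)) \<in> measurable ?P gw_space"
    by (rule measurable_compose[OF measurable_fst measurable_T_inf_space_left])
  have v [measurable]: "(\<lambda>z. visits n s (fst (fst z 0)) (snd z)) \<in> measurable ?P (count_space UNIV)" for n
    using measurable_compose[OF measurable_Pair[OF left measurable_snd] measurable_visits_gw[of n s]] by simp
  have 1: "(\<lambda>z. \<forall>n\<in>I 0. visits n s (fst (fst z 0)) (snd z) = 0) \<in> measurable ?P (count_space UNIV)"
    by (rule measurable_Ball_countable) measurable
  have "(\<lambda>z. spine_miss m (\<lambda>j. I (Suc j)) t (\<lambda>j. fst z (Suc j)) (\<lambda>u. snd z (i # u))) \<in> measurable ?P (count_space UNIV)" for t i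
    using measurable_compose[OF measurable_Pair[OF
        measurable_compose[OF measurable_fst measurable_T_inf_space_shift]
        measurable_compose[OF measurable_snd measurable_word_field_child[of i]]] Suc.IH[of "\<lambda>j. I (Suc j)" t]]
    by simp
  then have "(\<lambda>z. spine_miss m (\<lambda>j. I (Suc j)) (s + snd z [i]) (\<lambda>j. fst z (Suc j)) (\<lambda>u. snd z (i # u))) \<in> measurable ?P (count_space UNIV)" for i
    by (rule measurable_compose_countable)
      (intro measurable_add_countable measurable_const measurable_compose[OF measurable_snd measurable_word_field_component], simp)
  then have "(\<lambda>z. spine_miss m (\<lambda>j. I (Suc j)) (s + snd z [fst (fst z 0) []]) (\<lambda>j. fst z (Suc j)) (\<lambda>u. snd z (fst (fst z 0) [] # u)))
    \<in> measurable ?P (count_space UNIV)"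
    by (rule measurable_compose_countable[OF _ measurable_compose[OF left measurable_gw_component]])
  with 1 show ?case by simp
qed

definition spine_miss_prob :: "nat \<Rightarrow> (nat \<Rightarrow> nat set) \<Rightarrow> int ^ 'd::finite \<Rightarrow> ennreal" where
  "spine_miss_prob m I s = (\<integral>\<^sup>+ \<omega>. \<integral>\<^sup>+ x. of_bool (spine_miss m I s \<omega> x) \<partial>step_field \<partial>T_inf_space)"

lemma measurable_nn_integral_spine_miss:
  fixes s :: "int ^ 'd::finite"
  shows "(\<lambda>\<omega>. \<integral>\<^sup>+ x. of_bool (spine_miss m I s \<omega> x) \<partial>step_field) \<in> borel_measurable T_inf_space"
proof -
  interpret X: prob_space "step_field :: (nat list \<Rightarrow> int ^ 'd) measure" by (rule prob_space_word_field)
  show ?thesis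
    using measurable_compose[OF measurable_spine_miss[of m I s], of of_bool borel]
    by (intro X.borel_measurable_nn_integral) (simp add: case_prod_unfold)
qed

lemma measurable_spine_miss_walk:
  fixes s :: "int ^ 'd::finite"
  shows "(\<lambda>x. spine_miss m I s \<omega> x) \<in> measurable step_field (count_space UNIV)"
  using measurable_compose[OF measurable_Pair1' measurable_spine_miss[of m I s], of \<omega>]
  by (simp add: T_inf_space_def gw_space_def space_PiM space_pair_measure)

lemma finite_set_pmf_srw_step: "finite (set_pmf (srw_step :: (int ^ 'd::finite) pmf))"
  unfolding srw_step_def by (subst set_pmf_of_set) auto

lemma spine_miss_cong:
  "(\<And>u. u \<noteq> [] \<Longrightarrow> x u = y u) \<Longrightarrow> spine_miss m I s \<omega> x = spine_miss m I s \<omega> y"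
  using visits_cong[of x y] by (cases m) auto

text \<open>With \<open>\<omega>\<close> fixed, the first left tree reads only words in
  \<open>?A\<close>, and the exploration from the next spine vertex reads only words that start with
  \<open>?k []\<close>. Resampling outside \<open>?A\<close> turns the integral into a
  product.\<close>

lemma nn_integral_spine_miss_Suc:
  fixes s :: "int ^ 'd::finite"
  shows "(\<integral>\<^sup>+ x. of_bool (spine_miss (Suc m) I s \<omega> x) \<partial>step_field) =
    (\<integral>\<^sup>+ x. of_bool (\<forall>n\<in>I 0. visits n s (fst (\<omega> 0)) x = 0) \<partial>step_field) *
    (\<integral>\<^sup>+ e. \<integral>\<^sup>+ x. of_bool (spine_miss m (\<lambda>j. I (Suc j)) (s + e) (\<lambda>j. \<omega> (Suc j)) x) \<partial>step_field \<partial>srw_step)"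
proof -
  let ?k = "fst (\<omega> 0)" and ?\<omega>' = "\<lambda>j. \<omega> (Suc j)" and ?I' = "\<lambda>j. I (Suc j)"
  let ?A = "{u. u \<noteq> [] \<and> hd u < ?k []}"
  let ?f = "\<lambda>x. of_bool (\<forall>n\<in>I 0. visits n s ?k x = 0) :: ennreal"
  let ?g = "\<lambda>x. of_bool (spine_miss m ?I' (s + x [?k []]) ?\<omega>' (\<lambda>u. x (?k [] # u))) :: ennreal"
  have f: "?f \<in> borel_measurable step_field"
    by (rule measurable_compose[where g = of_bool and N = "count_space UNIV"], rule measurable_Ball_countable, measurable)
  have t: "(\<lambda>x. s + x [i]) \<in> measurable step_field (count_space UNIV)" for i
    by (intro measurable_add_countable measurable_const measurable_word_field_component) simp
  have g: "?g \<in> borel_measurable step_field"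
    by (rule measurable_compose[where g = of_bool and N = "count_space UNIV"],
        rule measurable_compose_countable[OF measurable_compose[OF measurable_word_field_child measurable_spine_miss_walk] t]) simp
  have "(\<integral>\<^sup>+ x. of_bool (spine_miss (Suc m) I s \<omega> x) \<partial>step_field) = (\<integral>\<^sup>+ x. ?f x * ?g x \<partial>step_field)"
    by (intro nn_integral_cong) simp
  also have "\<dots> = (\<integral>\<^sup>+ x. \<integral>\<^sup>+ y. ?f (\<lambda>u. if u \<in> ?A then x u else y u) * ?g (\<lambda>u. if u \<in> ?A then x u else y u)
      \<partial>step_field \<partial>step_field)"
    using f g by (intro nn_integral_word_field_mix) (rule borel_measurable_times_ennreal)
  also have "\<dots> = (\<integral>\<^sup>+ x. \<integral>\<^sup>+ y. ?f x * ?g y \<partial>step_field \<partial>step_field)"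
  proof (intro nn_integral_cong)
    fix x y :: "nat list \<Rightarrow> int ^ 'd"
    have "visits n s ?k (\<lambda>u. if u \<in> ?A then x u else y u) = visits n s ?k x" for n
      by (rule visits_cong_tree) simp
    then show "?f (\<lambda>u. if u \<in> ?A then x u else y u) * ?g (\<lambda>u. if u \<in> ?A then x u else y u) = ?f x * ?g y"
      by simp
  qed
  also have "\<dots> = (\<integral>\<^sup>+ x. ?f x \<partial>step_field) * (\<integral>\<^sup>+ y. ?g y \<partial>step_field)"
    using f g by (simp add: nn_integral_cmult nn_integral_multc)
  also have "(\<integral>\<^sup>+ y. ?g y \<partial>step_field) =
    (\<integral>\<^sup>+ e. \<integral>\<^sup>+ x. of_bool (spine_miss m ?I' (s + e) ?\<omega>' x) \<partial>step_field \<partial>srw_step)"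
    by (rule nn_integral_step_root[where f = "\<lambda>t x. of_bool (spine_miss m ?I' t ?\<omega>' x)"])
      (rule measurable_compose[OF measurable_spine_miss_walk], simp, rule arg_cong[where f = of_bool], rule spine_miss_cong, blast)
  finally show ?thesis .
qed

text \<open>After the walk has been integrated out, the first factor depends on
  \<open>\<omega> 0\<close> and the second on the shifted configuration. These are independent, and
  the shift preserves the law.\<close>

lemma spine_miss_prob_Suc:
  fixes s :: "int ^ 'd::finite"
  shows "spine_miss_prob (Suc m) I s =
    miss_prob (I 0) s * (\<integral>\<^sup>+ e. spine_miss_prob m (\<lambda>j. I (Suc j)) (s + e) \<partial>srw_step)"
proof -
  interpret X: prob_space "step_field :: (nat list \<Rightarrow> int ^ 'd) measure" by (rule prob_space_word_field)
  interpret G: prob_space gw_space by (rule prob_space_gw_space)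
  let ?f = "\<lambda>k. \<integral>\<^sup>+ x. of_bool (\<forall>n\<in>I 0. visits n s k x = 0) \<partial>step_field"
  let ?h = "\<lambda>\<omega>. \<integral>\<^sup>+ e. \<integral>\<^sup>+ x. of_bool (spine_miss m (\<lambda>j. I (Suc j)) (s + e) \<omega> x) \<partial>step_field \<partial>srw_step"
  let ?S = "set_pmf (srw_step :: (int ^ 'd) pmf)"
  \<comment> \<open>The step law has finite support, so its integral is a finite sum, which commutes
    with the integral over trees.\<close>
  have h_eq: "?h \<omega> = (\<Sum>e\<in>?S. (\<integral>\<^sup>+ x. of_bool (spine_miss m (\<lambda>j. I (Suc j)) (s + e) \<omega> x) \<partial>step_field) * ennreal (pmf srw_step e))" for \<omega>
    by (rule nn_integral_measure_pmf_finite[OF finite_set_pmf_srw_step]) simp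
  have f: "?f \<in> borel_measurable gw_space"
  proof -
    have v [measurable]: "(\<lambda>z. visits n s (fst z) (snd z)) \<in> measurable (gw_space \<Otimes>\<^sub>M step_field) (count_space UNIV)" for n
      using measurable_visits_gw[of n s] by (simp add: case_prod_unfold)
    have "(\<lambda>z. \<forall>n\<in>I 0. visits n s (fst z) (snd z) = 0) \<in> measurable (gw_space \<Otimes>\<^sub>M step_field) (count_space UNIV)"
      by (rule measurable_Ball_countable) measurable
    from measurable_compose[OF this, of of_bool borel] show ?thesis
      by (intro X.borel_measurable_nn_integral) (simp add: case_prod_unfold)
  qed
  have h: "?h \<in> borel_measurable T_inf_space"
    unfolding h_eq by (intro borel_measurable_sum borel_measurable_times_ennreal measurable_nn_integral_spine_miss) simp
  have f0: "(\<lambda>\<omega>. ?f (fst (\<omega> 0))) \<in> borel_measurable T_inf_space"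
    by (rule measurable_compose[OF measurable_T_inf_space_left f])
  have h': "(\<lambda>\<omega>. ?h (\<lambda>j. \<omega> (Suc j))) \<in> borel_measurable T_inf_space"
    by (rule measurable_compose[OF measurable_T_inf_space_shift h])
  have pg: "prob_space (gw_space \<Otimes>\<^sub>M gw_space)" by (intro prob_space_pair prob_space_gw_space)
  have "spine_miss_prob (Suc m) I s = (\<integral>\<^sup>+ \<omega>. ?f (fst (\<omega> 0)) * ?h (\<lambda>j. \<omega> (Suc j)) \<partial>T_inf_space)"
    unfolding spine_miss_prob_def nn_integral_spine_miss_Suc ..
  also have "\<dots> = (\<integral>\<^sup>+ \<omega>. \<integral>\<^sup>+ \<omega>'. ?f (fst (\<omega> 0)) * ?h (\<lambda>j. \<omega>' (Suc j)) \<partial>T_inf_space \<partial>T_inf_space)"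
    using nn_integral_PiM_mix[OF pg, of "\<lambda>\<omega>. ?f (fst (\<omega> 0)) * ?h (\<lambda>j. \<omega> (Suc j))" "{0}"]
      borel_measurable_times_ennreal[OF f0 h'] unfolding T_inf_space_def by simp
  also have "\<dots> = (\<integral>\<^sup>+ \<omega>. ?f (fst (\<omega> 0)) \<partial>T_inf_space) * (\<integral>\<^sup>+ \<omega>. ?h (\<lambda>j. \<omega> (Suc j)) \<partial>T_inf_space)"
    using f0 h' by (simp add: nn_integral_cmult nn_integral_multc)
  also have "(\<integral>\<^sup>+ \<omega>. ?h (\<lambda>j. \<omega> (Suc j)) \<partial>T_inf_space) = (\<integral>\<^sup>+ \<omega>. ?h \<omega> \<partial>T_inf_space)"
    using h unfolding T_inf_space_def by (intro nn_integral_PiM_reindex[where g = Suc] pg) auto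
  also have "\<dots> = (\<integral>\<^sup>+ e. spine_miss_prob m (\<lambda>j. I (Suc j)) (s + e) \<partial>srw_step)"
    unfolding h_eq nn_integral_measure_pmf_finite[OF finite_set_pmf_srw_step zero_le] spine_miss_prob_def
    by (subst nn_integral_sum)
      (auto intro!: sum.cong nn_integral_multc borel_measurable_times_ennreal measurable_nn_integral_spine_miss)
  also have "(\<integral>\<^sup>+ \<omega>. ?f (fst (\<omega> 0)) \<partial>T_inf_space) = (\<integral>\<^sup>+ p. ?f (fst p) \<partial>(gw_space \<Otimes>\<^sub>M gw_space))"
    unfolding T_inf_space_def
    by (rule nn_integral_PiM_component[OF pg, where f = "\<lambda>p. ?f (fst p)"]) (rule measurable_compose[OF measurable_fst f])
  also have "\<dots> = (\<integral>\<^sup>+ k. \<integral>\<^sup>+ k'. ?f k \<partial>gw_space \<partial>gw_space)"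
    by (subst G.nn_integral_fst[symmetric]) (auto intro: measurable_compose[OF measurable_fst f])
  also have "\<dots> = miss_prob (I 0) s"
    by (simp add: miss_prob_def G.emeasure_space_1)
  finally show ?thesis .
qed

subsection \<open>Divergence of the hitting probabilities\<close>

lemma step_avg_mono: "(\<And>t. f t \<le> g t) \<Longrightarrow> step_avg f s \<le> step_avg g s"
  unfolding step_avg_def by (intro divide_right_mono sum_mono add_mono) auto

lemma step_avg_const [simp]: "step_avg (\<lambda>_. c) s = c"
  by (simp add: step_avg_def)

lemma step_avg_add: "step_avg (\<lambda>t. f t + g t) s = step_avg f s + step_avg g s"
  by (simp add: step_avg_def sum.distrib add_divide_distrib[symmetric] algebra_simps)

lemma step_avg_cmult: "step_avg (\<lambda>t. c * f t) s = c * step_avg f s"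
  by (simp add: step_avg_def sum_distrib_left distrib_left)

lemma step_avg_sum: "step_avg (\<lambda>t. \<Sum>j\<in>J. f j t) s = (\<Sum>j\<in>J. step_avg (f j) s)"
  by (induction J rule: infinite_finite_induct) (simp_all add: step_avg_add)

lemma step_avg_funpow_mono: "(\<And>t. f t \<le> g t) \<Longrightarrow> (step_avg ^^ n) f s \<le> (step_avg ^^ n) g s"
  by (induction n arbitrary: s) (auto intro: step_avg_mono)

lemma step_avg_funpow_const [simp]: "(step_avg ^^ n) (\<lambda>_. c) = (\<lambda>_. c)"
  by (induction n) auto

lemma step_avg_funpow_add: "(step_avg ^^ n) (\<lambda>t. f t + g t) = (\<lambda>s. (step_avg ^^ n) f s + (step_avg ^^ n) g s)"
  by (induction n) (auto simp: step_avg_add intro!: ext)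

lemma step_avg_funpow_cmult: "(step_avg ^^ n) (\<lambda>t. c * f t) = (\<lambda>s. c * (step_avg ^^ n) f s)"
  by (induction n) (auto simp: step_avg_cmult intro!: ext)

lemma step_avg_funpow_sum: "(step_avg ^^ n) (\<lambda>t. \<Sum>j\<in>J. f j t) = (\<lambda>s. \<Sum>j\<in>J. (step_avg ^^ n) (f j) s)"
  by (induction n) (auto simp: step_avg_sum intro!: ext)

lemma hit_prob_uminus: "hit_prob n (- s) = hit_prob n s"
proof (induction n arbitrary: s)
  case (Suc n)
  have "hit_prob n (- s + axis j 1) = hit_prob n (s - axis j 1)"
    "hit_prob n (- s - axis j 1) = hit_prob n (s + axis j 1)" for j
    using Suc.IH[of "s - axis j 1"] Suc.IH[of "s + axis j 1"] by (simp_all add: algebra_simps)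
  then show ?case by (simp add: hit_prob_Suc step_avg_def add.commute)
qed (simp add: hit_prob_0)

lemma step_avg_funpow_point:
  "(step_avg ^^ n) (\<lambda>t. if t = y then 1 else 0) = (\<lambda>s. hit_prob n (s - y))"
proof (induction n)
  case (Suc n)
  have "step_avg (\<lambda>s. hit_prob n (s - y)) s = hit_prob (Suc n) (s - y)" for s
    unfolding hit_prob_Suc step_avg_def by (simp add: algebra_simps)
  then show ?case by (simp add: Suc.IH)
qed (auto simp: hit_prob_0 intro!: ext)

definition sq_norm :: "int ^ 'd::finite \<Rightarrow> real" where
  "sq_norm s = (\<Sum>i\<in>UNIV. (real_of_int (s $ i))\<^sup>2)"

text \<open>The mixed terms of \<open>s + axis j 1\<close> and \<open>s - axis j 1\<close> cancel.
  Hence the squared norm minus the time is a martingale, and the walk from 0 has second moment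
  \<open>n\<close> at time \<open>n\<close>, as Chebyshev's inequality requires.\<close>

lemma step_avg_sq_norm: "step_avg sq_norm s = sq_norm s + 1"
proof -
  have "sq_norm (s + axis j 1) + sq_norm (s - axis j 1) = 2 * sq_norm s + 2" for j
  proof -
    have "sq_norm (s + axis j 1) + sq_norm (s - axis j 1) =
      (\<Sum>i\<in>UNIV. 2 * (real_of_int (s $ i))\<^sup>2 + (if i = j then 2 else 0))"
      unfolding sq_norm_def sum.distrib[symmetric]
      by (intro sum.cong) (auto simp: axis_def power2_eq_square algebra_simps)
    then show ?thesis by (simp add: sum.distrib sum_distrib_left sq_norm_def)
  qed
  then show ?thesis by (simp add: step_avg_def field_simps)
qed

lemma step_avg_funpow_sq_norm: "(step_avg ^^ n) sq_norm = (\<lambda>s. sq_norm s + real n)"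
  by (induction n) (auto simp: step_avg_add step_avg_sq_norm intro!: ext)

lemma finite_card_box:
  "finite {y :: int ^ 'd::finite. \<forall>i. \<bar>y $ i\<bar> \<le> int R}"
  "card {y :: int ^ 'd::finite. \<forall>i. \<bar>y $ i\<bar> \<le> int R} \<le> (2 * R + 1) ^ CARD('d)"
proof -
  let ?P = "PiE (UNIV :: 'd set) (\<lambda>_. {- int R..int R})"
  have sub: "{y :: int ^ 'd::finite. \<forall>i. \<bar>y $ i\<bar> \<le> int R} \<subseteq> vec_lambda ` ?P"
  proof
    fix y :: "int ^ 'd" assume "y \<in> {y. \<forall>i. \<bar>y $ i\<bar> \<le> int R}"
    then have "vec_nth y \<in> ?P" by (auto simp: abs_le_iff minus_le_iff)
    then show "y \<in> vec_lambda ` ?P" by (metis image_eqI vec_nth_inverse)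
  qed
  have fin: "finite ?P" by (intro finite_PiE) auto
  show "finite {y :: int ^ 'd::finite. \<forall>i. \<bar>y $ i\<bar> \<le> int R}"
    using sub fin finite_subset by blast
  have "card {y :: int ^ 'd::finite. \<forall>i. \<bar>y $ i\<bar> \<le> int R} \<le> card (vec_lambda ` ?P)"
    using sub fin by (intro card_mono) auto
  also have "\<dots> \<le> card ?P" using fin by (rule card_image_le)
  also have "\<dots> = (2 * R + 1) ^ CARD('d)"
    by (simp add: card_PiE nat_add_distrib nat_mult_distrib)
  finally show "card {y :: int ^ 'd::finite. \<forall>i. \<bar>y $ i\<bar> \<le> int R} \<le> (2 * R + 1) ^ CARD('d)" .
qed

text \<open>
  The probability is at most the mean of \<open>exp (- Z)\<close>, where \<open>Z\<close> is the sum of the \<open>b j * g j\<close> along the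
  walk. As \<open>exp (- x) \<le> exp (- a / 2) + 2 / a * (a - x)\<close> for \<open>0 \<le> x \<le> a\<close>, only the mean of \<open>Z\<close> matters;
  \<open>z\<close> is the part of the sum that has already been collected.
\<close>

lemma spine_miss_prob_le:
  fixes s :: "int ^ 'd::finite"
  assumes a: "0 < a" and z: "0 \<le> z" "z + (\<Sum>j<m. b j) \<le> a"
    and b: "\<And>j. 0 \<le> b j" and g: "\<And>j (t :: int ^ 'd). 0 \<le> g j t" "\<And>j (t :: int ^ 'd). g j t \<le> 1"
    and miss: "\<And>j (t :: int ^ 'd). miss_prob (I j) t \<le> ennreal (1 - b j * g j t)"
  shows "spine_miss_prob m I s \<le> ennreal (exp z *
    (exp (- a / 2) + 2 / a * (a - z - (\<Sum>j<m. b j * (step_avg ^^ j) (g j) s))))"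
  using z b g miss
proof (induction m arbitrary: I s z b g)
  case 0
  interpret X: prob_space "step_field :: (nat list \<Rightarrow> int ^ 'd) measure" by (rule prob_space_word_field)
  interpret T: prob_space T_inf_space by (rule prob_space_T_inf_space)
  \<comment> \<open>From \<open>a / 2\<close> on the first term suffices; before it the linear term
    alone is at least 1.\<close>
  have "exp (- z) \<le> exp (- a / 2) + 2 / a * (a - z)"
  proof (cases "a / 2 \<le> z")
    case True
    then have "exp (- z) \<le> exp (- a / 2)" by simp
    then show ?thesis using a 0 by (intro add_increasing2) auto
  next
    case False
    then have "1 \<le> 2 / a * (a - z)" using a by (simp add: field_simps)
    moreover have "exp (- z) \<le> 1" using 0 by simp
    ultimately show ?thesis by (smt (verit) exp_gt_zero)
  qed
  then have "exp z * exp (- z) \<le> exp z * (exp (- a / 2) + 2 / a * (a - z))"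
    by (intro mult_left_mono) auto
  then have "1 \<le> exp z * (exp (- a / 2) + 2 / a * (a - z))"
    by (simp add: exp_minus)
  then have "1 \<le> ennreal (exp z * (exp (- a / 2) + 2 / a * (a - z)))"
    by simp
  then show ?case
    by (simp add: spine_miss_prob_def X.emeasure_space_1 T.emeasure_space_1)
next
  case (Suc m)
  define w where "w = z + b 0 * g 0 s"
  let ?Z = "\<lambda>t. \<Sum>j<m. b (Suc j) * (step_avg ^^ j) (g (Suc j)) t"
  define F where "F t = exp w * (exp (- a / 2) + 2 / a * (a - w - ?Z t))" for t
  have bg: "0 \<le> b 0 * g 0 s" "b 0 * g 0 s \<le> b 0"
    using Suc.prems(3)[of 0] Suc.prems(4)[of 0 s] Suc.prems(5)[of 0 s] by (auto intro: mult_left_le)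
  have w: "0 \<le> w" "w + (\<Sum>j<m. b (Suc j)) \<le> a"
    using Suc.prems(1,2) bg unfolding w_def sum.lessThan_Suc_shift by auto
  have Z: "?Z t \<le> (\<Sum>j<m. b (Suc j))" for t
  proof (intro sum_mono)
    fix j
    have "(step_avg ^^ j) (g (Suc j)) t \<le> (step_avg ^^ j) (\<lambda>_. 1) t"
      by (intro step_avg_funpow_mono Suc.prems)
    then show "b (Suc j) * (step_avg ^^ j) (g (Suc j)) t \<le> b (Suc j)"
      using Suc.prems(3)[of "Suc j"] by (intro mult_left_le) auto
  qed
  have F: "0 \<le> F t" for t
    using Z[of t] w a unfolding F_def by (intro mult_nonneg_nonneg add_nonneg_nonneg) auto
  \<comment> \<open>\<open>F\<close> is affine in \<open>?Z\<close>, so averaging passes inside.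
    This is the gain from replacing the exponential by a linear bound.\<close>
  have avgF: "step_avg F s = exp w * (exp (- a / 2) + 2 / a * (a - w - (\<Sum>j<m. b (Suc j) * (step_avg ^^ Suc j) (g (Suc j)) s)))"
  proof -
    have F_eq: "F = (\<lambda>t. exp w * (exp (- a / 2) + 2 / a * (a - w)) + (- (exp w * (2 / a))) * ?Z t)"
    proof
      have "x * (E + c * (P - Q)) = x * (E + c * P) + (- (x * c)) * Q" for x E c P Q :: real
        by (simp add: algebra_simps)
      then show "F t = exp w * (exp (- a / 2) + 2 / a * (a - w)) + (- (exp w * (2 / a))) * ?Z t" for t
        unfolding F_def .
    qed
    have "step_avg F s = exp w * (exp (- a / 2) + 2 / a * (a - w)) +
        (- (exp w * (2 / a))) * (\<Sum>j<m. b (Suc j) * (step_avg ^^ Suc j) (g (Suc j)) s)"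
      unfolding F_eq by (simp only: step_avg_add step_avg_cmult step_avg_sum step_avg_const) simp
    also have "\<dots> = exp w * (exp (- a / 2) + 2 / a * (a - w - (\<Sum>j<m. b (Suc j) * (step_avg ^^ Suc j) (g (Suc j)) s)))"
    proof -
      have "x * (E + c * P) + (- (x * c)) * Q = x * (E + c * (P - Q))" for x E c P Q :: real
        by (simp add: algebra_simps)
      then show ?thesis .
    qed
    finally show ?thesis .
  qed
  have "spine_miss_prob (Suc m) I s = miss_prob (I 0) s * (\<integral>\<^sup>+ e. spine_miss_prob m (\<lambda>j. I (Suc j)) (s + e) \<partial>srw_step)"
    by (rule spine_miss_prob_Suc)
  also have "\<dots> \<le> ennreal (exp (- (b 0 * g 0 s))) * (\<integral>\<^sup>+ e. ennreal (F (s + e)) \<partial>srw_step)"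
  proof (intro mult_mono nn_integral_mono)
    \<comment> \<open>Each miss probability becomes an exponential factor, and \<open>exp w\<close>
      shrinks to \<open>exp z\<close> when multiplied by it.\<close>
    have "1 - b 0 * g 0 s \<le> exp (- (b 0 * g 0 s))"
      using exp_ge_add_one_self[of "- (b 0 * g 0 s)"] by simp
    then show "miss_prob (I 0) s \<le> ennreal (exp (- (b 0 * g 0 s)))"
      using Suc.prems(6)[of 0 s] order_trans[OF _ ennreal_leI] by blast
    show "spine_miss_prob m (\<lambda>j. I (Suc j)) (s + e) \<le> ennreal (F (s + e))" for e
      unfolding F_def by (intro Suc.IH[of w "\<lambda>j. b (Suc j)" "\<lambda>j. g (Suc j)"] w Suc.prems)
  qed auto
  also have "\<dots> = ennreal (exp (- (b 0 * g 0 s)) * step_avg F s)"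
    using F by (subst nn_integral_srw_step) (auto simp: ennreal_mult step_avg_nonneg)
  also have "exp (- (b 0 * g 0 s)) * step_avg F s =
    exp z * (exp (- a / 2) + 2 / a * (a - z - (\<Sum>j<Suc m. b j * (step_avg ^^ j) (g j) s)))"
  proof -
    have "exp (- (b 0 * g 0 s)) * exp w = exp z" unfolding w_def by (simp add: exp_add[symmetric])
    moreover have "(\<Sum>j<Suc m. b j * (step_avg ^^ j) (g j) s) =
      b 0 * g 0 s + (\<Sum>j<m. b (Suc j) * (step_avg ^^ Suc j) (g (Suc j)) s)"
      unfolding sum.lessThan_Suc_shift by simp
    ultimately show ?thesis unfolding avgF w_def by (simp only: mult.assoc[symmetric] diff_diff_eq add.assoc)
  qed
  finally show ?case .
qed

section \<open>Blocks of heights between powers of four\<close>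

definition block :: "nat \<Rightarrow> nat set" where
  "block k = {4 ^ k..<4 ^ (k + 1)}"

text \<open>The index of the block that contains \<open>n\<close>; in addition
  \<open>level 0 = 0\<close>, although 0 lies in no block.\<close>

definition level :: "nat \<Rightarrow> nat" where
  "level n = (LEAST k. n < 4 ^ (k + 1))"

lemma finite_block [simp]: "finite (block k)" by (simp add: block_def)

lemma card_block: "card (block k) = 3 * 4 ^ k" by (simp add: block_def)

lemma level_block: "n \<in> block k \<Longrightarrow> level n = k"
proof (unfold level_def, rule Least_equality)
  fix j assume n: "n \<in> block k" "n < 4 ^ (j + 1)"
  then have "(4::nat) ^ k < 4 ^ (j + 1)" by (auto simp: block_def)
  then have "k < j + 1" by (rule power_less_imp_less_exp[rotated]) simp
  then show "k \<le> j" by simp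
qed (simp add: block_def)

lemma sum_lessThan_4_power:
  "(\<Sum>n<4 ^ M. f n) = f 0 + (\<Sum>k<M. \<Sum>n\<in>block k. f n)" for f :: "nat \<Rightarrow> real"
proof (induction M)
  case (Suc M)
  have "{..<4 ^ Suc M} = {..<4 ^ M} \<union> block M" "{..<4 ^ M} \<inter> block M = {}"
    by (auto simp: block_def)
  then have "(\<Sum>n<4 ^ Suc M. f n) = (\<Sum>n<4 ^ M. f n) + (\<Sum>n\<in>block M. f n)"
    by (simp only: sum.union_disjoint finite_block finite_lessThan)
  then show ?case using Suc.IH by simp
qed (simp add: lessThan_Suc)

text \<open>At times of order \<open>4 ^ k\<close> the walk lives on the scale \<open>2 ^ k\<close>,
  so the box has radius \<open>R = 2 ^ k * r\<close>. Inside it at most \<open>(3 * R) ^ d\<close>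
  bad points count, each bounded by the hypothesis. Outside it the indicator is at most
  \<open>sq_norm y / R^2\<close>, of mean \<open>n / R^2\<close>; the 12 is the block size
  \<open>3 * 4 ^ k\<close> times the bound \<open>4 ^ (k + 1)\<close> on \<open>n\<close>, divided
  by \<open>4 ^ k * 4 ^ k\<close>.\<close>

lemma sum_bad_le:
  fixes B :: "(int ^ 'd::finite) set"
  assumes r: "1 \<le> r" and \<epsilon>: "0 \<le> \<epsilon>"
    and B: "\<And>y. y \<in> B \<Longrightarrow> (\<Sum>n\<in>block k. hit_prob n y) \<le> \<epsilon> * 4 ^ k / 2 ^ (k * CARD('d))"
  shows "(\<Sum>n\<in>block k. (step_avg ^^ n) (\<lambda>y. of_bool (y \<in> B)) 0)
    \<le> 4 ^ k * (\<epsilon> * (3 * real r) ^ CARD('d) + 12 / (real r)\<^sup>2)"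
proof -
  define R where "R = 2 ^ k * r"
  have R: "1 \<le> R" using r unfolding R_def by (simp add: Suc_leI)
  let ?box = "{y :: int ^ 'd. \<forall>i. \<bar>y $ i\<bar> \<le> int R}"
  let ?C = "B \<inter> ?box"
  have fin: "finite ?C" using finite_card_box(1) by blast
  have pt: "of_bool (y \<in> B) \<le> (\<Sum>c\<in>?C. if y = c then 1 else 0) + 1 / (real R)\<^sup>2 * sq_norm y" for y
  proof (cases "y \<in> ?box")
    case True
    have "0 \<le> sq_norm y" unfolding sq_norm_def by (intro sum_nonneg) auto
    with True fin show ?thesis by (auto simp: sum.delta')
  next
    case False
    then obtain i where i: "int R \<le> \<bar>y $ i\<bar>" by (auto simp: not_le intro: less_imp_le)
    then have "real R \<le> \<bar>real_of_int (y $ i)\<bar>" by linarith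
    then have "(real R)\<^sup>2 \<le> (real_of_int (y $ i))\<^sup>2"
      using power_mono[of "real R" "\<bar>real_of_int (y $ i)\<bar>" 2] by simp
    also have "\<dots> \<le> sq_norm y" unfolding sq_norm_def by (intro member_le_sum) auto
    finally have "1 \<le> 1 / (real R)\<^sup>2 * sq_norm y" using R by (simp add: field_simps)
    moreover have "0 \<le> (\<Sum>c\<in>?C. if y = c then 1 else (0::real))" by (intro sum_nonneg) auto
    ultimately show ?thesis by (auto simp: of_bool_def)
  qed
  have "(\<Sum>n\<in>block k. (step_avg ^^ n) (\<lambda>y. of_bool (y \<in> B)) 0) \<le>
    (\<Sum>n\<in>block k. (step_avg ^^ n) (\<lambda>y. (\<Sum>c\<in>?C. if y = c then 1 else 0) + 1 / (real R)\<^sup>2 * sq_norm y) 0)"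
    by (intro sum_mono step_avg_funpow_mono pt)
  also have "\<dots> = (\<Sum>n\<in>block k. (\<Sum>c\<in>?C. hit_prob n c) + 1 / (real R)\<^sup>2 * real n)"
  proof -
    have "sq_norm (0 :: int ^ 'd) = 0" by (simp add: sq_norm_def)
    then show ?thesis
      by (simp only: step_avg_funpow_add step_avg_funpow_sum step_avg_funpow_point step_avg_funpow_cmult
          step_avg_funpow_sq_norm diff_0 hit_prob_uminus add_0)
  qed
  also have "\<dots> = (\<Sum>c\<in>?C. \<Sum>n\<in>block k. hit_prob n c) + 1 / (real R)\<^sup>2 * (\<Sum>n\<in>block k. real n)"
    by (simp only: sum.distrib sum_distrib_left sum.swap[of _ ?C])
  also have "\<dots> \<le> (\<Sum>c\<in>?C. \<epsilon> * 4 ^ k / 2 ^ (k * CARD('d))) + 1 / (real R)\<^sup>2 * (\<Sum>n\<in>block k. 4 ^ (k + 1))"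
  proof (intro add_mono sum_mono mult_left_mono)
    fix n assume "n \<in> block k"
    then have "n \<le> 4 ^ (k + 1)" by (simp add: block_def)
    then have "real n \<le> real (4 ^ (k + 1))" by (rule of_nat_mono)
    then show "real n \<le> 4 ^ (k + 1)" by simp
  qed (use B in auto)
  also have "(\<Sum>c\<in>?C. \<epsilon> * 4 ^ k / 2 ^ (k * CARD('d))) \<le> (3 * real R) ^ CARD('d) * (\<epsilon> * 4 ^ k / 2 ^ (k * CARD('d)))"
  proof -
    have "card ?C \<le> card ?box" by (intro card_mono finite_card_box(1)) auto
    also have "\<dots> \<le> (2 * R + 1) ^ CARD('d)" by (rule finite_card_box(2))
    also have "\<dots> \<le> (3 * R) ^ CARD('d)" using R by (intro power_mono) auto
    finally have "real (card ?C) \<le> real ((3 * R) ^ CARD('d))" by (rule of_nat_mono)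
    then have "real (card ?C) \<le> (3 * real R) ^ CARD('d)" by simp
    then show ?thesis using \<epsilon> unfolding sum_constant by (intro mult_right_mono) auto
  qed
  also have "(3 * real R) ^ CARD('d) * (\<epsilon> * 4 ^ k / 2 ^ (k * CARD('d))) = 4 ^ k * (\<epsilon> * (3 * real r) ^ CARD('d))"
    by (simp add: R_def power_mult_distrib power_mult field_simps)
  also have "1 / (real R)\<^sup>2 * (\<Sum>n\<in>block k. 4 ^ (k + 1)) = 4 ^ k * (12 / (real r)\<^sup>2)"
  proof -
    have "(real R)\<^sup>2 = 4 ^ k * (real r)\<^sup>2"
      by (simp add: R_def power_mult_distrib power_mult[symmetric] mult.commute[of k 2]) (simp add: power_mult)
    then show ?thesis by (simp add: card_block)
  qed
  finally show ?thesis by (simp add: algebra_simps)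
qed

text \<open>Each block has \<open>3 * 4 ^ j\<close> terms, none above \<open>1 / 4 ^ j\<close>, and
  so contributes at most 3.\<close>

lemma harmonic_sum_le: "(\<Sum>q<4 ^ j. 1 / real (Suc q)) \<le> 1 + 3 * real j"
proof (induction j)
  case (Suc j)
  have "{..<4 ^ Suc j} = {..<4 ^ j} \<union> block j" "{..<4 ^ j} \<inter> block j = {}"
    by (auto simp: block_def)
  then have "(\<Sum>q<4 ^ Suc j. 1 / real (Suc q)) = (\<Sum>q<4 ^ j. 1 / real (Suc q)) + (\<Sum>q\<in>block j. 1 / real (Suc q))"
    by (simp only: sum.union_disjoint finite_block finite_lessThan)
  also have "(\<Sum>q\<in>block j. 1 / real (Suc q)) \<le> (\<Sum>q\<in>block j. 1 / 4 ^ j)"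
  proof (intro sum_mono divide_left_mono)
    fix q assume "q \<in> block j"
    then have "4 ^ j \<le> Suc q" by (simp add: block_def)
    then have "real (4 ^ j) \<le> real (Suc q)" by (rule of_nat_mono)
    then show "4 ^ j \<le> real (Suc q)" by simp
  qed auto
  also have "\<dots> = 3" by (simp add: card_block)
  finally show ?case using Suc.IH by simp
qed simp

text \<open>With \<open>x = sqrt (q + 1)\<close> a summand is
  \<open>C * x ^ (4 - d) / (q + 1)\<close>. For \<open>d \<le> 4\<close> the power is at most
  \<open>(3 * 2 ^ k) ^ (4 - d)\<close> on this range, and a harmonic sum remains. It yields the
  factor \<open>k + 1\<close>, the only growth left when \<open>d = 4\<close>. The constant is
  \<open>567 = 81 * 7\<close> with \<open>81 = 3 ^ 4\<close>.\<close>

lemma sum_kernel_bound: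
  assumes d: "d \<le> 4" and C: "0 < C"
  shows "(\<Sum>q<2 * 4 ^ (k + 1). real (Suc q) * (C / sqrt (real (Suc q)) ^ d)) \<le> 567 * C * real (k + 1) * 2 ^ (k * (4 - d))"
proof -
  have s: "sqrt (real (2 * 4 ^ (k + 1))) \<le> 3 * 2 ^ k"
  proof (rule real_le_lsqrt)
    have "(3 * 2 ^ k :: real)\<^sup>2 = 9 * 4 ^ k"
      by (simp add: power_mult_distrib power_mult[symmetric] mult.commute[of k 2]) (simp add: power_mult)
    then show "real (2 * 4 ^ (k + 1)) \<le> (3 * 2 ^ k)\<^sup>2" by simp
  qed auto
  have "real (Suc q) * (C / sqrt (real (Suc q)) ^ d) \<le> C * (81 * 2 ^ (k * (4 - d))) * (1 / real (Suc q))"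
    if q: "q < 2 * 4 ^ (k + 1)" for q
  proof -
    let ?x = "sqrt (real (Suc q))"
    have x: "0 < ?x" "?x ^ 4 = real (Suc q) * real (Suc q)"
      by (simp_all add: power4_eq_xxxx)
    have "?x ^ d * ?x ^ (4 - d) = ?x ^ 4" using d by (simp add: power_add[symmetric])
    then have "real (Suc q) * (C / ?x ^ d) = C * ?x ^ (4 - d) * (1 / real (Suc q))"
      using x by (simp add: field_simps del: of_nat_Suc)
    also have "?x ^ (4 - d) \<le> (3 * 2 ^ k) ^ (4 - d)"
    proof (intro power_mono order_trans[OF _ s])
      have "Suc q \<le> 2 * 4 ^ (k + 1)" using q by simp
      then show "?x \<le> sqrt (real (2 * 4 ^ (k + 1)))" by (intro real_sqrt_le_mono of_nat_mono)
    qed auto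
    also have "(3 * 2 ^ k :: real) ^ (4 - d) = 3 ^ (4 - d) * 2 ^ (k * (4 - d))"
      by (simp add: power_mult_distrib power_mult)
    also have "(3::real) ^ (4 - d) * 2 ^ (k * (4 - d)) \<le> 81 * 2 ^ (k * (4 - d))"
      using power_increasing[of "4 - d" 4 "3::real"] by (intro mult_right_mono) auto
    finally show ?thesis using C by (simp add: mult_right_mono mult_left_mono divide_right_mono)
  qed
  then have "(\<Sum>q<2 * 4 ^ (k + 1). real (Suc q) * (C / sqrt (real (Suc q)) ^ d)) \<le>
    (\<Sum>q<2 * 4 ^ (k + 1). C * (81 * 2 ^ (k * (4 - d))) * (1 / real (Suc q)))"
    by (intro sum_mono) auto
  also have "\<dots> = C * (81 * 2 ^ (k * (4 - d))) * (\<Sum>q<2 * 4 ^ (k + 1). 1 / real (Suc q))"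
    by (simp add: sum_distrib_left)
  also have "\<dots> \<le> C * (81 * 2 ^ (k * (4 - d))) * (7 * real (k + 1))"
  proof (intro mult_left_mono)
    have "(\<Sum>q<2 * 4 ^ (k + 1). 1 / real (Suc q)) \<le> (\<Sum>q<4 ^ (k + 2). 1 / real (Suc q))"
      by (intro sum_mono2) auto
    also have "\<dots> \<le> 1 + 3 * real (k + 2)" by (rule harmonic_sum_le)
    finally show "(\<Sum>q<2 * 4 ^ (k + 1). 1 / real (Suc q)) \<le> 7 * real (k + 1)" by simp
  qed (use C in auto)
  also have "\<dots> = 567 * C * real (k + 1) * 2 ^ (k * (4 - d))" by simp
  finally show ?thesis .
qed

subsection \<open>Recurrence and transience\<close>

lemma level_le: "level n \<le> n"
  unfolding level_def
proof (rule Least_le)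
  show "n < 4 ^ (n + 1)" by (induction n) auto
qed

text \<open>
  Early trees get an empty window, so that every hit lies at height more than \<open>A\<close>.
\<close>

definition windows :: "nat \<Rightarrow> nat \<Rightarrow> nat set" where
  "windows A n = (if level n \<le> A then {} else block (level n))"

lemma harmonic_tail_unbounded:
  fixes c :: real
  assumes "0 < c"
  shows "\<exists>M. L \<le> (\<Sum>k<M. if k \<le> A then 0 else c / real (k + 1))"
proof (rule ccontr)
  let ?f = "\<lambda>k. if k \<le> A then 0 else c / real (k + 1)"
  assume "\<not> ?thesis"
  then have "(\<Sum>k<M. ?f k) \<le> L" for M by (simp add: not_le less_imp_le)
  then have "summable ?f" using assms by (intro summableI_nonneg_bounded[of ?f L]) auto
  moreover have "eventually (\<lambda>k. ?f k = c / real (k + 1)) sequentially"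
    using eventually_gt_at_top[of A] by eventually_elim auto
  ultimately have "summable (\<lambda>k. c / real (k + 1))"
    using summable_cong by force
  then have "summable (\<lambda>k. inverse c * (c / real (k + 1)))" by (rule summable_mult)
  then have "summable (\<lambda>k. inverse (real (Suc k)))"
    using assms by (simp add: field_simps)
  then show False
    using not_summable_harmonic[where 'a = real] by (subst (asm) summable_Suc_iff) simp
qed

lemma miss_prob_le_1: "miss_prob I s \<le> 1"
proof -
  interpret X: prob_space "step_field :: (nat list \<Rightarrow> int ^ 'a) measure" by (rule prob_space_word_field)
  interpret G: prob_space gw_space by (rule prob_space_gw_space)
  have "miss_prob I s \<le> (\<integral>\<^sup>+ k. \<integral>\<^sup>+ x. 1 \<partial>(step_field :: (nat list \<Rightarrow> int ^ 'a) measure) \<partial>gw_space)"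
    unfolding miss_prob_def by (intro nn_integral_mono) (auto simp: of_bool_def)
  then show ?thesis by (simp add: X.emeasure_space_1 G.emeasure_space_1)
qed

text \<open>Once the total weight \<open>a\<close> is large, the exponential term of
  \<open>spine_miss_prob_le\<close> is at most \<open>\<delta>\<close>. The bad points lose at most
  the fraction \<open>\<delta>\<close> of \<open>a\<close>, so the linear term is at most
  \<open>2 * \<delta>\<close>.\<close>

lemma spine_miss_prob_small:
  assumes d: "CARD('d::finite) \<le> 4" and \<delta>: "0 < \<delta>"
  shows "\<exists>m. spine_miss_prob m (windows A) (0 :: int ^ 'd) \<le> ennreal (3 * \<delta>)"
proof -
  let ?d = "CARD('d)"
  obtain C where C: "0 < C" "\<And>n (s :: int ^ 'd). hit_prob n s \<le> C / sqrt (real (Suc n)) ^ ?d"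
    using hit_prob_upper by blast
  \<comment> \<open>\<open>r\<close> makes the Chebyshev part of \<open>sum_bad_le\<close> at most
    \<open>\<delta>\<close>; \<open>\<epsilon>\<close> is then chosen to make the part inside the
    box equal to \<open>\<delta>\<close>.\<close>
  define r where "r = nat \<lceil>12 / \<delta>\<rceil> + 1"
  have r: "1 \<le> r" "12 / (real r)\<^sup>2 \<le> \<delta>"
  proof -
    show r1: "1 \<le> r" by (simp add: r_def)
    have "12 / \<delta> \<le> real r" unfolding r_def by linarith
    also have "real r \<le> (real r)\<^sup>2" using r1 by (simp add: power2_eq_square)
    finally show "12 / (real r)\<^sup>2 \<le> \<delta>" using \<delta> r1 by (simp add: field_simps)
  qed
  define \<epsilon> where "\<epsilon> = \<delta> / (3 * real r) ^ ?d"
  have \<epsilon>: "0 < \<epsilon>" "\<epsilon> * (3 * real r) ^ ?d = \<delta>" using \<delta> r by (auto simp: \<epsilon>_def)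
  define B where "B k = {y :: int ^ 'd. (\<Sum>n\<in>block k. hit_prob n y) \<le> \<epsilon> * 4 ^ k / 2 ^ (k * ?d)}" for k
  \<comment> \<open>Off the bad set this is \<open>\<epsilon> * 4 ^ k / 2 ^ (k * d)\<close> divided
    by \<open>4 * Y\<close>, with \<open>Y\<close> from \<open>sum_kernel_bound\<close> and
    \<open>2268 = 4 * 567\<close>; the powers of 2 combine to \<open>4 ^ k * 4 ^ k\<close>.\<close>
  define \<beta> where "\<beta> k = (if k \<le> A then 0 else \<epsilon> / (2268 * C * real (k + 1) * 4 ^ k))" for k
  have \<beta>0: "0 \<le> \<beta> k" for k using C \<epsilon> by (simp add: \<beta>_def)
  define g where "g n t = (of_bool (t \<notin> B (level n)) :: real)" for n t
  have miss: "miss_prob (windows A j) t \<le> ennreal (1 - \<beta> (level j) * g j t)" for j t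
  proof (cases "level j \<le> A \<or> t \<in> B (level j)")
    case True
    then have "\<beta> (level j) * g j t = 0" by (auto simp: \<beta>_def g_def)
    then show ?thesis by (simp only:) (simp add: miss_prob_le_1)
  next
    case False
    define k where "k = level j"
    define Y where "Y = 567 * C * real (k + 1) * 2 ^ (k * (4 - ?d))"
    have Y: "0 < Y" using C by (simp add: Y_def)
    have "miss_prob (windows A j) t \<le> ennreal (1 - (\<Sum>n\<in>block k. hit_prob n t) / (4 * Y))"
    proof -
      have "windows A j = block k" "block k \<subseteq> {..<4 ^ (k + 1)}"
        using False by (auto simp: windows_def k_def block_def)
      moreover have "miss_prob (block k) t \<le> ennreal (1 - (\<Sum>n\<in>block k. hit_prob n t) / (4 * Y))"
        by (rule miss_prob_le[OF _ C(2) _ Y, of _ "4 ^ (k + 1)"], fact,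
          unfold Y_def, rule sum_kernel_bound[OF d C(1)])
      ultimately show ?thesis by (simp only:)
    qed
    also have "\<dots> \<le> ennreal (1 - \<beta> (level j) * g j t)"
    proof (intro ennreal_leI diff_left_mono)
      have p: "(2::real) ^ (k * ?d) * 2 ^ (k * (4 - ?d)) = 4 ^ k * 4 ^ k"
      proof -
        have "k * ?d + k * (4 - ?d) = k * (?d + (4 - ?d))" by (rule distrib_left[symmetric])
        also have "\<dots> = 2 * k + 2 * k" using d by simp
        finally have "k * ?d + k * (4 - ?d) = 2 * k + 2 * k" .
        then have "(2::real) ^ (k * ?d) * 2 ^ (k * (4 - ?d)) = 2 ^ (2 * k + 2 * k)" by (simp only: power_add[symmetric])
        also have "(2::real) ^ (2 * k + 2 * k) = 4 ^ k * 4 ^ k"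
          unfolding power_add power_mult by simp
        finally show ?thesis .
      qed
      have "\<beta> (level j) * g j t = \<epsilon> / (2268 * C * real (k + 1) * 4 ^ k)"
        using False by (simp add: \<beta>_def g_def k_def)
      also have "\<dots> = \<epsilon> * 4 ^ k / (2268 * C * real (k + 1) * (4 ^ k * 4 ^ k))"
        by simp
      also have "\<dots> = \<epsilon> * 4 ^ k / 2 ^ (k * ?d) / (4 * Y)"
        unfolding p[symmetric] Y_def by simp
      also have "\<dots> \<le> (\<Sum>n\<in>block k. hit_prob n t) / (4 * Y)"
        using False Y by (intro divide_right_mono) (auto simp: B_def k_def)
      finally show "\<beta> (level j) * g j t \<le> (\<Sum>n\<in>block k. hit_prob n t) / (4 * Y)" .
    qed
    finally show ?thesis .
  qed
  have c: "0 < 3 * \<epsilon> / (2268 * C)" using C \<epsilon> by simp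
  \<comment> \<open>The lower bound 1 allows division by \<open>a\<close>, and the logarithm gives
    \<open>exp (- a / 2) \<le> \<delta>\<close>.\<close>
  obtain M where M: "max 1 (2 * ln (1 / \<delta>)) \<le> (\<Sum>k<M. if k \<le> A then 0 else 3 * \<epsilon> / (2268 * C) / real (k + 1))"
    using harmonic_tail_unbounded[OF c] by blast
  define a where "a = (\<Sum>n<4 ^ M. \<beta> (level n))"
  have level0: "level 0 = 0" using level_le[of 0] by simp
  \<comment> \<open>The index 0 lies outside all blocks but contributes nothing, because
    \<open>\<beta> 0 = 0\<close>.\<close>
  have blocks: "(\<Sum>n<4 ^ M. \<beta> (level n) * f n (level n)) = (\<Sum>k<M. \<beta> k * (\<Sum>n\<in>block k. f n k))" for f
  proof -
    have "(\<Sum>n<4 ^ M. \<beta> (level n) * f n (level n)) = (\<Sum>k<M. \<Sum>n\<in>block k. \<beta> (level n) * f n (level n))"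
      unfolding sum_lessThan_4_power level0 by (simp add: \<beta>_def)
    also have "\<dots> = (\<Sum>k<M. \<Sum>n\<in>block k. \<beta> k * f n k)"
      by (intro sum.cong refl) (simp add: level_block)
    finally show ?thesis by (simp add: sum_distrib_left)
  qed
  have a_eq: "a = (\<Sum>k<M. \<beta> k * (3 * 4 ^ k))"
    using blocks[of "\<lambda>_ _. 1"] by (simp add: a_def card_block)
  also have "\<dots> = (\<Sum>k<M. if k \<le> A then 0 else 3 * \<epsilon> / (2268 * C) / real (k + 1))"
    by (intro sum.cong refl) (simp add: \<beta>_def)
  finally have a: "1 \<le> a" "2 * ln (1 / \<delta>) \<le> a" using M by auto
  define Z where "Z = (\<Sum>j<4 ^ M. \<beta> (level j) * (step_avg ^^ j) (g j) (0 :: int ^ 'd))"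
  have "a - Z = (\<Sum>n<4 ^ M. \<beta> (level n) * (step_avg ^^ n) (\<lambda>t. of_bool (t \<in> B (level n))) 0)"
  proof -
    have "(step_avg ^^ n) (g n) 0 = 1 - (step_avg ^^ n) (\<lambda>t. of_bool (t \<in> B (level n))) 0" for n
    proof -
      have "g n = (\<lambda>t. 1 + (- 1) * of_bool (t \<in> B (level n)))" by (auto simp: g_def)
      then have "(step_avg ^^ n) (g n) 0 = 1 + (- 1) * (step_avg ^^ n) (\<lambda>t. of_bool (t \<in> B (level n))) 0"
        by (simp only: step_avg_funpow_add step_avg_funpow_cmult step_avg_funpow_const)
      then show ?thesis by simp
    qed
    then show ?thesis
      unfolding a_def Z_def sum_subtractf[symmetric] by (intro sum.cong refl) (simp add: right_diff_distrib)
  qed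
  also have "\<dots> = (\<Sum>k<M. \<beta> k * (\<Sum>n\<in>block k. (step_avg ^^ n) (\<lambda>t. of_bool (t \<in> B k)) 0))"
    by (rule blocks)
  also have "\<dots> \<le> (\<Sum>k<M. \<beta> k * (4 ^ k * (\<epsilon> * (3 * real r) ^ ?d + 12 / (real r)\<^sup>2)))"
    using r \<epsilon> by (intro sum_mono mult_left_mono \<beta>0 sum_bad_le) (auto simp: B_def)
  \<comment> \<open>The bracket is at most \<open>2 * \<delta>\<close>; rounding up to
    \<open>3 * \<delta>\<close> matches the block size \<open>3 * 4 ^ k\<close> in
    \<open>a_eq\<close>.\<close>
  also have "\<dots> \<le> (\<Sum>k<M. \<beta> k * (4 ^ k * (3 * \<delta>)))"
    using r \<epsilon> \<delta> by (intro sum_mono mult_left_mono \<beta>0) auto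
  also have "\<dots> = \<delta> * a" by (simp add: a_eq sum_distrib_left mult_ac)
  finally have aZ: "a - Z \<le> \<delta> * a" .
  have "spine_miss_prob (4 ^ M) (windows A) (0 :: int ^ 'd) \<le> ennreal (exp 0 * (exp (- a / 2) + 2 / a * (a - 0 - Z)))"
    unfolding Z_def using a
    by (intro spine_miss_prob_le \<beta>0 miss) (auto simp: a_def g_def)
  also have "\<dots> \<le> ennreal (3 * \<delta>)"
  proof (intro ennreal_leI)
    have "exp (- a / 2) \<le> exp (- ln (1 / \<delta>))" using a by simp
    also have "\<dots> = \<delta>" using \<delta> by (simp add: ln_div)
    finally have "exp (- a / 2) \<le> \<delta>" .
    moreover have "2 / a * (a - Z) \<le> 2 / a * (\<delta> * a)" using aZ a by (intro mult_left_mono) auto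
    ultimately show "exp 0 * (exp (- a / 2) + 2 / a * (a - 0 - Z)) \<le> 3 * \<delta>" using a by simp
  qed
  finally show ?thesis by blast
qed

lemma AE_not_spine_miss:
  assumes d: "CARD('d::finite) \<le> 4"
  shows "AE z in T_inf_space \<Otimes>\<^sub>M step_field. \<exists>m. \<not> spine_miss m (windows A) (0 :: int ^ 'd) (fst z) (snd z)"
proof -
  interpret X: prob_space "step_field :: (nat list \<Rightarrow> int ^ 'd) measure" by (rule prob_space_word_field)
  let ?P = "T_inf_space \<Otimes>\<^sub>M (step_field :: (nat list \<Rightarrow> int ^ 'd) measure)"
  let ?N = "\<lambda>m. {z \<in> space ?P. spine_miss m (windows A) (0 :: int ^ 'd) (fst z) (snd z)}"
  note measurable_spine_miss [measurable]
  have N: "?N m \<in> sets ?P" for m by measurable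
  have prob: "emeasure ?P (?N m) = spine_miss_prob m (windows A) (0 :: int ^ 'd)" for m
  proof -
    have "emeasure ?P (?N m) = (\<integral>\<^sup>+ z. indicator (?N m) z \<partial>?P)"
      using N by (rule nn_integral_indicator[symmetric])
    also have "\<dots> = (\<integral>\<^sup>+ z. of_bool (spine_miss m (windows A) (0 :: int ^ 'd) (fst z) (snd z)) \<partial>?P)"
      by (intro nn_integral_cong) (auto simp: indicator_def)
    also have "\<dots> = spine_miss_prob m (windows A) (0 :: int ^ 'd)"
      unfolding spine_miss_prob_def
      using measurable_compose[OF measurable_spine_miss, of of_bool borel]
      by (subst X.nn_integral_fst[symmetric]) auto
    finally show ?thesis .
  qed
  have "emeasure ?P (\<Inter>m. ?N m) \<le> 0"
  proof (rule ennreal_le_epsilon)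
    fix e :: real assume "0 < e"
    then obtain m where "spine_miss_prob m (windows A) (0 :: int ^ 'd) \<le> ennreal (3 * (e / 3))"
      using spine_miss_prob_small[OF d, of "e / 3" A] by auto
    moreover have "emeasure ?P (\<Inter>m. ?N m) \<le> emeasure ?P (?N m)"
      using N by (intro emeasure_mono) auto
    ultimately show "emeasure ?P (\<Inter>m. ?N m) \<le> 0 + ennreal e" by (simp add: prob)
  qed
  then show ?thesis
    using N by (intro AE_I[of _ _ "\<Inter>m. ?N m"]) auto
qed

text \<open>Almost surely there is, for each of the countably many \<open>A\<close>, a zero at
  height above \<open>A\<close>. A finite set of zeros would have bounded height.\<close>

lemma recurrent_if_le_4:
  assumes d: "CARD('d::finite) \<le> 4"
  shows "tree_walk_recurrent T_inf_space T_inf (srw_step :: (int ^ 'd) pmf)"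
proof -
  have "AE z in T_inf_space \<Otimes>\<^sub>M step_field. \<forall>A. \<exists>m. \<not> spine_miss m (windows A) (0 :: int ^ 'd) (fst z) (snd z)"
    using AE_not_spine_miss[OF d] by (simp add: AE_all_countable)
  then have "AE z in T_inf_space \<Otimes>\<^sub>M step_field. infinite {u \<in> T_inf (fst z). tree_walk (snd z) u = (0 :: int ^ 'd)}"
  proof eventually_elim
    fix z :: "spine_config \<times> (nat list \<Rightarrow> int ^ 'd)"
    assume *: "\<forall>A. \<exists>m. \<not> spine_miss m (windows A) 0 (fst z) (snd z)"
    let ?V = "{u \<in> T_inf (fst z). tree_walk (snd z) u = 0}"
    have "\<exists>w\<in>?V. A < length w" for A
    proof -
      obtain m where "\<not> spine_miss m (windows A) 0 (fst z) (snd z)" using * by blast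
      then obtain j n u where j: "n \<in> windows A j" "u \<in> gw_tree (fst (fst z j))"
        "0 + tree_walk (snd z) (spine (fst z) j @ u) = 0"
        by (rule not_spine_missE)
      \<comment> \<open>The window of \<open>j\<close> is nonempty, so
        \<open>j \<ge> level j > A\<close>, and the zero lies at or below the \<open>j\<close>-th
        spine vertex.\<close>
      have "A < j" using j(1) level_le[of j] by (auto simp: windows_def split: if_splits)
      then show ?thesis using j T_inf_left[where \<omega> = "fst z" and n = j and u = u] by (intro bexI[of _ "spine (fst z) j @ u"]) auto
    qed
    moreover have "\<exists>A. \<forall>w\<in>?V. length w \<le> A" if "finite ?V"
      using that by (intro exI[of _ "Max (length ` ?V)"]) auto
    ultimately show "infinite ?V" by (meson not_less)
  qed
  then show ?thesis
    unfolding tree_walk_recurrent_def word_field_def by (simp add: case_prod_unfold)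
qed

section \<open>Generation sizes and transience for \<open>d \<ge> 5\<close>\<close>

lemma gw_tree_level:
  "finite {u \<in> gw_tree k. length u = n}" "card {u \<in> gw_tree k. length u = n} = gen_size n k"
proof (induction n arbitrary: k)
  case 0
  have *: "{u \<in> gw_tree k. length u = 0} = {[]}" for k by auto
  { case 1 show ?case unfolding * by simp next case 2 show ?case unfolding * by simp }
next
  case (Suc n)
  have *: "{u \<in> gw_tree k. length u = Suc n} =
    (\<Union>i\<in>{..<k []}. (#) i ` {u \<in> gw_tree (\<lambda>w. k (i # w)). length u = n})" for k
    by (auto simp: length_Suc_conv Cons_in_gw_tree_iff image_iff)
  { case 1 show ?case unfolding * using Suc.IH(1) by auto
  next
    case 2
    have "card {u \<in> gw_tree k. length u = Suc n} =
      (\<Sum>i<k []. card ((#) i ` {u \<in> gw_tree (\<lambda>w. k (i # w)). length u = n}))"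
      unfolding * by (intro card_UN_disjoint) (use Suc.IH(1) in auto)
    then show ?case by (simp add: card_image Suc.IH(2)) }
qed

text \<open>The \<open>m\<close>-th spine vertex is counted twice, as the root of both its grafted
  trees. This keeps the terms uniform and makes the mean exactly \<open>2 * (m + 1)\<close>.\<close>

definition level_bound :: "nat \<Rightarrow> spine_config \<Rightarrow> nat" where
  "level_bound m \<omega> = (\<Sum>n\<le>m. gen_size (m - n) (fst (\<omega> n)) + gen_size (m - n) (snd (\<omega> n)))"

lemma T_inf_level:
  "finite {w \<in> T_inf \<omega>. length w = m}" "card {w \<in> T_inf \<omega>. length w = m} \<le> level_bound m \<omega>"
proof -
  let ?L = "\<lambda>n. (@) (spine \<omega> n) ` {u \<in> gw_tree (fst (\<omega> n)). length u = m - n}"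
  \<comment> \<open>For \<open>n = m\<close> the only \<open>v\<close> is empty and
    \<open>hd v\<close> is an unspecified value; the extra word is harmless in a covering
    set.\<close>
  let ?R = "\<lambda>n. (\<lambda>v. spine \<omega> n @ (fst (\<omega> n) [] + 1 + hd v) # tl v) ` {u \<in> gw_tree (snd (\<omega> n)). length u = m - n}"
  have fin: "finite (?L n \<union> ?R n)" for n using gw_tree_level(1) by auto
  have sub: "{w \<in> T_inf \<omega>. length w = m} \<subseteq> (\<Union>n\<in>{..m}. ?L n \<union> ?R n)"
  proof
    fix w assume "w \<in> {w \<in> T_inf \<omega>. length w = m}"
    then have "w \<in> T_inf \<omega>" and m: "length w = m" by auto
    from this(1) show "w \<in> (\<Union>n\<in>{..m}. ?L n \<union> ?R n)"
    proof (cases rule: T_infE)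
      case (left n u)
      then show ?thesis using m by (intro UN_I[of n]) auto
    next
      case (right n i u)
      then have "w \<in> ?R n" using m by (intro image_eqI[of _ _ "i # u"]) auto
      then show ?thesis using right m by (intro UN_I[of n]) auto
    qed
  qed
  show "finite {w \<in> T_inf \<omega>. length w = m}"
    using sub by (rule finite_subset) (use fin in auto)
  have "card {w \<in> T_inf \<omega>. length w = m} \<le> card (\<Union>n\<in>{..m}. ?L n \<union> ?R n)"
    using sub by (rule card_mono[rotated]) (use fin in auto)
  also have "\<dots> \<le> (\<Sum>n\<le>m. card (?L n \<union> ?R n))" by (rule card_UN_le) simp
  also have "\<dots> \<le> level_bound m \<omega>"
    unfolding level_bound_def
  proof (intro sum_mono)
    fix n
    have "card (?L n \<union> ?R n) \<le> card (?L n) + card (?R n)" by (rule card_Un_le)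
    also have "\<dots> \<le> gen_size (m - n) (fst (\<omega> n)) + gen_size (m - n) (snd (\<omega> n))"
      using card_image_le[OF gw_tree_level(1), of _ "fst (\<omega> n)" "m - n"]
        card_image_le[OF gw_tree_level(1), of _ "snd (\<omega> n)" "m - n"]
      unfolding gw_tree_level(2) by (intro add_mono) auto
    finally show "card (?L n \<union> ?R n) \<le> gen_size (m - n) (fst (\<omega> n)) + gen_size (m - n) (snd (\<omega> n))" .
  qed
  finally show "card {w \<in> T_inf \<omega>. length w = m} \<le> level_bound m \<omega>" .
qed

lemma measurable_gen_size_T_inf:
  "(\<lambda>\<omega>. of_nat (gen_size l (fst (\<omega> n))) :: ennreal) \<in> borel_measurable T_inf_space"
  "(\<lambda>\<omega>. of_nat (gen_size l (snd (\<omega> n))) :: ennreal) \<in> borel_measurable T_inf_space"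
proof -
  have gs: "(\<lambda>k. of_nat (gen_size l k) :: ennreal) \<in> borel_measurable gw_space"
    by (rule measurable_compose[OF measurable_gen_size_gw]) simp
  show "(\<lambda>\<omega>. of_nat (gen_size l (fst (\<omega> n))) :: ennreal) \<in> borel_measurable T_inf_space"
    by (rule measurable_compose[OF measurable_T_inf_space_left gs])
  show "(\<lambda>\<omega>. of_nat (gen_size l (snd (\<omega> n))) :: ennreal) \<in> borel_measurable T_inf_space"
    by (rule measurable_compose[OF measurable_T_inf_space_right gs])
qed

lemma measurable_level_bound:
  "(\<lambda>\<omega>. of_nat (level_bound m \<omega>) :: ennreal) \<in> borel_measurable T_inf_space"
  unfolding level_bound_def of_nat_sum of_nat_add
  by (intro borel_measurable_sum borel_measurable_add measurable_gen_size_T_inf)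

lemma nn_integral_level_bound:
  "(\<integral>\<^sup>+ \<omega>. of_nat (level_bound m \<omega>) \<partial>T_inf_space) = of_nat (2 * (m + 1))"
proof -
  interpret G: prob_space gw_space by (rule prob_space_gw_space)
  interpret GG: pair_prob_space gw_space gw_space ..
  have pg: "prob_space (gw_space \<Otimes>\<^sub>M gw_space)" by (intro prob_space_pair prob_space_gw_space)
  have gs [measurable]: "(\<lambda>k. of_nat (gen_size l k) :: ennreal) \<in> borel_measurable gw_space" for l
    by (rule measurable_compose[OF measurable_gen_size_gw]) simp
  have l: "(\<integral>\<^sup>+ \<omega>. of_nat (gen_size l (fst (\<omega> n))) \<partial>T_inf_space) = 1" for l n
  proof -
    have "(\<integral>\<^sup>+ \<omega>. of_nat (gen_size l (fst (\<omega> n))) \<partial>T_inf_space) =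
      (\<integral>\<^sup>+ p. of_nat (gen_size l (fst p)) \<partial>(gw_space \<Otimes>\<^sub>M gw_space))"
      unfolding T_inf_space_def
      by (rule nn_integral_PiM_component[OF pg, where f = "\<lambda>p. of_nat (gen_size l (fst p))"]) measurable
    also have "\<dots> = 1"
      by (subst G.nn_integral_fst[symmetric]) (simp_all add: G.emeasure_space_1 nn_integral_gen_size)
    finally show ?thesis .
  qed
  have r: "(\<integral>\<^sup>+ \<omega>. of_nat (gen_size l (snd (\<omega> n))) \<partial>T_inf_space) = 1" for l n
  proof -
    have "(\<integral>\<^sup>+ \<omega>. of_nat (gen_size l (snd (\<omega> n))) \<partial>T_inf_space) =
      (\<integral>\<^sup>+ p. of_nat (gen_size l (snd p)) \<partial>(gw_space \<Otimes>\<^sub>M gw_space))"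
      unfolding T_inf_space_def
      by (rule nn_integral_PiM_component[OF pg, where f = "\<lambda>p. of_nat (gen_size l (snd p))"]) measurable
    also have "\<dots> = 1"
      by (subst G.nn_integral_fst[symmetric]) (simp_all add: G.emeasure_space_1 nn_integral_gen_size)
    finally show ?thesis .
  qed
  have "(\<integral>\<^sup>+ \<omega>. of_nat (level_bound m \<omega>) \<partial>T_inf_space) =
    (\<Sum>n\<le>m. (\<integral>\<^sup>+ \<omega>. of_nat (gen_size (m - n) (fst (\<omega> n))) \<partial>T_inf_space) +
      (\<integral>\<^sup>+ \<omega>. of_nat (gen_size (m - n) (snd (\<omega> n))) \<partial>T_inf_space))"
    unfolding level_bound_def of_nat_sum of_nat_add
    by (subst nn_integral_sum)
      (auto intro!: sum.cong nn_integral_add borel_measurable_add measurable_gen_size_T_inf)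
  then show ?thesis by (simp add: l r mult.commute)
qed

lemma measurable_tree_walk:
  "(\<lambda>x. tree_walk x w) \<in> measurable (step_field :: (nat list \<Rightarrow> int ^ 'd::finite) measure) (count_space UNIV)"
proof (induction w)
  case (Cons i u)
  have "(\<lambda>x. x [i] + tree_walk (\<lambda>v. x (i # v)) u) \<in> measurable (step_field :: (nat list \<Rightarrow> int ^ 'd) measure) (count_space UNIV)"
    by (intro measurable_add_countable measurable_word_field_component
        measurable_compose[OF measurable_word_field_child Cons.IH])
  then show ?case by (simp add: tree_walk_Cons)
qed simp

lemma nn_integral_tree_walk:
  fixes s :: "int ^ 'd::finite"
  shows "(\<integral>\<^sup>+ x. of_bool (s + tree_walk x w = 0) \<partial>step_field) = ennreal (hit_prob (length w) s)"
proof (induction w arbitrary: s)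
  case Nil
  interpret X: prob_space "step_field :: (nat list \<Rightarrow> int ^ 'd) measure" by (rule prob_space_word_field)
  show ?case by (simp add: hit_prob_0 X.emeasure_space_1)
next
  case (Cons i u)
  have "(\<integral>\<^sup>+ x. of_bool (s + tree_walk x (i # u) = 0) \<partial>step_field) =
    (\<integral>\<^sup>+ x. of_bool (s + x [i] + tree_walk (\<lambda>v. x (i # v)) u = 0) \<partial>step_field)"
    by (simp add: tree_walk_Cons add.assoc)
  also have "\<dots> = (\<integral>\<^sup>+ e. \<integral>\<^sup>+ x. of_bool (s + e + tree_walk x u = 0) \<partial>step_field \<partial>srw_step)"
  proof (rule nn_integral_step_root[where f = "\<lambda>t x. of_bool (t + tree_walk x u = 0)"])
    show "(\<lambda>x. of_bool (t + tree_walk x u = 0) :: ennreal) \<in> borel_measurable step_field" for t :: "int ^ 'd"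
      by (rule measurable_compose[OF measurable_tree_walk]) simp
    fix t :: "int ^ 'd" and x y :: "nat list \<Rightarrow> int ^ 'd"
    assume xy: "\<And>u. u \<noteq> [] \<Longrightarrow> x u = y u"
    have "tree_walk x u = tree_walk y u"
      unfolding tree_walk_def by (intro sum.cong refl xy) auto
    then show "of_bool (t + tree_walk x u = 0) = (of_bool (t + tree_walk y u = 0) :: ennreal)" by simp
  qed
  also have "\<dots> = ennreal (hit_prob (length (i # u)) s)"
    by (simp add: Cons.IH nn_integral_srw_step hit_prob_nonneg hit_prob_Suc)
  finally show ?case .
qed

text \<open>Borel-Cantelli for a frozen tree: a union bound over generation \<open>m\<close> bounds
  the probability of a zero there. Almost surely only finitely many generations contain zeros, and
  each generation is finite.\<close>

lemma AE_finite_zeros: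
  assumes fin: "(\<Sum>m. of_nat (level_bound m \<omega>) * ennreal (hit_prob m (0 :: int ^ 'd::finite))) \<noteq> \<infinity>"
  shows "AE x in step_field. finite {w \<in> T_inf \<omega>. tree_walk x w = (0 :: int ^ 'd)}"
proof -
  interpret X: prob_space "step_field :: (nat list \<Rightarrow> int ^ 'd) measure" by (rule prob_space_word_field)
  let ?L = "\<lambda>m. {w \<in> T_inf \<omega>. length w = m}"
  let ?Z = "\<lambda>w. {x \<in> space step_field. tree_walk x w = (0 :: int ^ 'd)}"
  define V where "V m = (\<Union>w\<in>?L m. ?Z w)" for m
  have Z: "?Z w \<in> sets step_field" for w
    using measurable_sets[OF measurable_tree_walk[of w], of "{0}"] by (simp add: vimage_def Int_def conj_commute)
  have V: "V m \<in> sets step_field" for m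
    unfolding V_def using T_inf_level(1) Z by (intro sets.finite_UN) auto
  have "emeasure step_field (?Z w) = ennreal (hit_prob (length w) (0 :: int ^ 'd))" for w
  proof -
    have "emeasure step_field (?Z w) = (\<integral>\<^sup>+ x. indicator (?Z w) x \<partial>step_field)"
      using Z by (rule nn_integral_indicator[symmetric])
    also have "\<dots> = (\<integral>\<^sup>+ x. of_bool ((0 :: int ^ 'd) + tree_walk x w = 0) \<partial>step_field)"
      by (intro nn_integral_cong) (auto simp: indicator_def)
    finally show ?thesis by (simp only: nn_integral_tree_walk)
  qed
  note Z_prob = this
  have V_le: "emeasure step_field (V m) \<le> of_nat (level_bound m \<omega>) * ennreal (hit_prob m (0 :: int ^ 'd))" for m
  proof -
    have "emeasure step_field (V m) \<le> (\<Sum>w\<in>?L m. emeasure step_field (?Z w))"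
      unfolding V_def using T_inf_level(1) Z by (intro emeasure_subadditive_finite) auto
    also have "\<dots> = of_nat (card (?L m)) * ennreal (hit_prob m (0 :: int ^ 'd))"
      by (simp add: Z_prob)
    also have "\<dots> \<le> of_nat (level_bound m \<omega>) * ennreal (hit_prob m (0 :: int ^ 'd))"
      by (intro mult_right_mono of_nat_mono T_inf_level(2)) auto
    finally show ?thesis .
  qed
  have "(\<Sum>m. emeasure step_field (V m)) \<noteq> \<infinity>"
  proof -
    have "(\<Sum>m. emeasure step_field (V m)) \<le>
      (\<Sum>m. of_nat (level_bound m \<omega>) * ennreal (hit_prob m (0 :: int ^ 'd)))"
      by (intro suminf_le V_le summableI)
    with fin show ?thesis by (auto simp: top_unique)
  qed
  then have "summable (\<lambda>m. measure step_field (V m))"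
    unfolding X.emeasure_eq_measure by (intro summable_suminf_not_top) auto
  then have "AE x in step_field. eventually (\<lambda>m. x \<in> space step_field - V m) sequentially"
    by (intro borel_cantelli_AE1 V) (auto simp: X.emeasure_eq_measure)
  then show ?thesis
  proof eventually_elim
    fix x :: "nat list \<Rightarrow> int ^ 'd"
    assume "eventually (\<lambda>m. x \<in> space step_field - V m) sequentially"
    then obtain N where N: "\<And>m. N \<le> m \<Longrightarrow> x \<in> space step_field - V m"
      by (auto simp: eventually_sequentially)
    have "{w \<in> T_inf \<omega>. tree_walk x w = 0} \<subseteq> (\<Union>m<N. ?L m)"
      using N by (force simp: V_def not_less[symmetric])
    then show "finite {w \<in> T_inf \<omega>. tree_walk x w = 0}"
      by (rule finite_subset) (auto intro: T_inf_level(1))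
  qed
qed

text \<open>For \<open>d \<ge> 5\<close> the return probability is of order at most
  \<open>m powr (- 5 / 2)\<close>. The linear growth of the generations costs one power, and
  \<open>- 3 / 2\<close> is still summable.\<close>

lemma level_sum_finite:
  assumes d: "5 \<le> CARD('d::finite)"
  shows "(\<Sum>m. of_nat (2 * (m + 1)) * ennreal (hit_prob m (0 :: int ^ 'd))) \<noteq> \<infinity>"
proof -
  obtain C where C: "0 < C" "\<And>n (s :: int ^ 'd). hit_prob n s \<le> C / sqrt (real (Suc n)) ^ CARD('d)"
    using hit_prob_upper by blast
  let ?g = "\<lambda>m. 2 * C * real (Suc m) powr (- 3 / 2)"
  have "of_nat (2 * (m + 1)) * ennreal (hit_prob m (0 :: int ^ 'd)) \<le> ennreal (?g m)" for m
  proof -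
    have s1: "1 \<le> sqrt (real (Suc m))" by simp
    have "hit_prob m (0 :: int ^ 'd) \<le> C / sqrt (real (Suc m)) ^ CARD('d)" by (rule C(2))
    also have "\<dots> \<le> C / sqrt (real (Suc m)) ^ 5"
      using s1 C(1) d by (intro divide_left_mono power_increasing mult_pos_pos zero_less_power) auto
    also have "\<dots> = C * real (Suc m) powr (- 5 / 2)"
    proof -
      have "sqrt (real (Suc m)) ^ 5 = real (Suc m) powr (5 / 2)"
        using powr_realpow[of "real (Suc m) powr (1 / 2)" 5]
        by (simp add: powr_half_sqrt[symmetric] powr_powr del: of_nat_Suc)
      moreover have "real (Suc m) powr (- 5 / 2) = 1 / real (Suc m) powr (5 / 2)"
        using powr_minus_divide[of "real (Suc m)" "5 / 2"] by (simp only: minus_divide_left)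
      ultimately show ?thesis by (simp only: times_divide_eq_right mult_1_right)
    qed
    finally have "real (2 * (m + 1)) * hit_prob m (0 :: int ^ 'd) \<le> real (2 * (m + 1)) * (C * real (Suc m) powr (- 5 / 2))"
      by (intro mult_left_mono) auto
    also have "\<dots> = 2 * C * (real (Suc m) powr 1 * real (Suc m) powr (- 5 / 2))" by simp
    also have "\<dots> = ?g m" by (simp only: powr_add[symmetric]) simp
    finally have "ennreal (real (2 * (m + 1)) * hit_prob m (0 :: int ^ 'd)) \<le> ennreal (?g m)"
      by (rule ennreal_leI)
    then show ?thesis
      unfolding ennreal_of_nat_eq_real_of_nat by (subst ennreal_mult'[symmetric]) auto
  qed
  then have "(\<Sum>m. of_nat (2 * (m + 1)) * ennreal (hit_prob m (0 :: int ^ 'd))) \<le> (\<Sum>m. ennreal (?g m))"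
    by (intro suminf_le summableI)
  moreover have "summable ?g"
  proof (intro summable_mult)
    have "summable (\<lambda>m. real m powr (- 3 / 2))" by (simp add: summable_real_powr_iff)
    then show "summable (\<lambda>m. real (Suc m) powr (- 3 / 2))"
      by (subst summable_Suc_iff)
  qed
  then have "(\<Sum>m. ennreal (?g m)) \<noteq> \<infinity>"
    using C(1) by (subst suminf_ennreal2) auto
  ultimately show ?thesis by (auto simp: top_unique)
qed

text \<open>By monotone convergence the series of \<open>AE_finite_zeros\<close> has finite mean
  over the trees, so it is finite for almost every tree. Recurrence, sliced by
  \<open>AE_pair\<close>, would give almost every tree infinitely many zeros almost surely.\<close>

lemma not_recurrent_if_ge_5:
  assumes d: "5 \<le> CARD('d::finite)"
  shows "\<not> tree_walk_recurrent T_inf_space T_inf (srw_step :: (int ^ 'd) pmf)"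
proof
  assume "tree_walk_recurrent T_inf_space T_inf (srw_step :: (int ^ 'd) pmf)"
  then have inf: "AE z in T_inf_space \<Otimes>\<^sub>M step_field. infinite {u \<in> T_inf (fst z). tree_walk (snd z) u = (0 :: int ^ 'd)}"
    unfolding tree_walk_recurrent_def word_field_def by (simp add: case_prod_unfold)
  interpret X: prob_space "step_field :: (nat list \<Rightarrow> int ^ 'd) measure" by (rule prob_space_word_field)
  interpret T: prob_space T_inf_space by (rule prob_space_T_inf_space)
  interpret P: pair_prob_space T_inf_space "step_field :: (nat list \<Rightarrow> int ^ 'd) measure" ..
  let ?S = "\<lambda>\<omega>. \<Sum>m. of_nat (level_bound m \<omega>) * ennreal (hit_prob m (0 :: int ^ 'd))"
  have m: "(\<lambda>\<omega>. of_nat (level_bound m \<omega>) * ennreal (hit_prob m (0 :: int ^ 'd))) \<in> borel_measurable T_inf_space" for m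
    by (intro borel_measurable_times_ennreal measurable_level_bound) simp
  have "(\<integral>\<^sup>+ \<omega>. ?S \<omega> \<partial>T_inf_space) = (\<Sum>m. of_nat (2 * (m + 1)) * ennreal (hit_prob m (0 :: int ^ 'd)))"
    by (subst nn_integral_suminf[OF m]) (simp only: nn_integral_multc measurable_level_bound nn_integral_level_bound)
  then have "AE \<omega> in T_inf_space. ?S \<omega> \<noteq> \<infinity>"
    using level_sum_finite[OF d] m by (intro nn_integral_PInf_AE borel_measurable_suminf) auto
  moreover have "AE \<omega> in T_inf_space. AE x in step_field. infinite {u \<in> T_inf \<omega>. tree_walk x u = (0 :: int ^ 'd)}"
    using P.AE_pair[OF inf] by simp
  ultimately have "AE \<omega> in T_inf_space. False"
  proof eventually_elim
    case (elim \<omega>)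
    from AE_finite_zeros[OF elim(1)] elim(2) have "AE x in (step_field :: (nat list \<Rightarrow> int ^ 'd) measure). False"
      by eventually_elim simp
    then show False by (simp add: X.AE_False)
  qed
  then show False by (simp add: T.AE_False)
qed

theorem theorem1:
  "tree_walk_recurrent T_inf_space T_inf (srw_step :: (int ^ 'd::finite) pmf) \<longleftrightarrow> CARD('d) \<le> 4"
  using recurrent_if_le_4[where 'd = 'd] not_recurrent_if_ge_5[where 'd = 'd] by linarith

end
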